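(* Let $F$ be a function field of genus $g$ over $\mathbb{F}_q$, let $P_1,\dots,P_n$ be pairwise distinct rational places of $F$, $D=P_1+\cdots+P_n$, and let $G$ be a divisor with support disjoint from that of $D$. Let $1\le s\le\ell$ be integers. Then the usual Guruswami–Sudan list-decoder for $C_L(D,G)$ with multiplicity parameter $s$ and designed list size $\ell$ has list-decoding radius at least \[\frac{s(2\ell-s+1)n-\ell(\ell+1)\deg G-2}{2s(\ell+1)}-\frac{\ell}{\ell+1}\cdot\frac{g}{s}.\]
   Context: $F$ has full constant field $\mathbb{F}_q$. For a divisor $A$, $L(A)=\{h\in F\setminus\{0\}\mid (h)+A\ge 0\}\cup\{0\}$. The AG code is $C_L(D,G)=\{(f(P_1),\dots,f(P_n))\mid f\in L(G)\}\subseteq\mathbb{F}_q^n$. Multiplicity: for a rational place $P$, $r\in\mathbb{F}_q$ and $Q(z)\in F[z]$, $(P,r)$ is a zero of $Q$ with multiplicity at least $m$ if, for a local parameter $\phi$ of $P$, $Q(z)=\sum_{a,b\ge0,\ a+b\ge m}c_{a,b}\phi^a(z-r)^b$ with $c_{a,b}\in\mathbb{F}_q$ (power series expansion at $P$). Usual Guruswami–Sudan list-decoder with parameters $s,\ell$, for a target number of errors $\tau$ (an integer, $0\le\tau\le n$): fix any divisor $A$ with support disjoint from that of $D$ and $\deg A=s(n-\tau)-1$. On input $\mathbf r=(r_1,\dots,r_n)\in\mathbb{F}_q^n$, find a nonzero polynomial $Q(z)=\sum_{j=0}^{\ell}Q_jz^{j}\in F[z]$ with $Q_j\in L(A-jG)$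 for $j=0,\dots,\ell$ and such that each $(P_i,r_i)$, $i=1,\dots,n$, is a zero of $Q(z)$ with multiplicity at least $s$. If no such $Q$ exists, return the empty list; otherwise return all $f\in L(G)$ with $Q(f)=0$ and with $(f(P_1),\dots,f(P_n))$ at Hamming distance at most $\tau$ from $\mathbf r$. The list-decoder is said to have list-decoding radius at least a real number $X$ if for every integer $\tau$ with $0\le\tau\le n$ and $\tau\le X$, and every $\mathbf r\in\mathbb{F}_q^n$, the decoder with target $\tau$ (for any admissible choice of $A$ and $Q$) returns exactly the set of all $f\in L(G)$ whose codeword $(f(P_1),\dots,f(P_n))$ has Hamming distance at most $\tau$ from $\mathbf r$, this set having at most $\ell$ elements. *)

theory Defs
  imports
    Complex_Main
    "HOL-Computational_Algebra.Polynomial"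
    "HOL-Library.FuncSet"
    "HOL-Library.Poly_Mapping"
begin

section \<open>Function fields\<close>

text \<open>
  The constant field is a type \<open>'k\<close>, the function field a type \<open>'f\<close>, and
  \<open>\<kappa> :: 'k \<Rightarrow> 'f\<close> is the inclusion of the constants.
\<close>

definition transcendental_over :: "('k::field \<Rightarrow> 'f::field) \<Rightarrow> 'f \<Rightarrow> bool" where
  "transcendental_over \<kappa> x \<longleftrightarrow> (\<forall>p. p \<noteq> 0 \<longrightarrow> poly (map_poly \<kappa> p) x \<noteq> 0)"

definition simple_ext :: "('k::field \<Rightarrow> 'f::field) \<Rightarrow> 'f \<Rightarrow> 'f set" where
  "simple_ext \<kappa> x =
     {poly (map_poly \<kappa> p) x / poly (map_poly \<kappa> q) x | p q. poly (map_poly \<kappa> q) x \<noteq> 0}"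

text \<open>An algebraic function field of one variable: a finite extension of some \<open>K(x)\<close> with \<open>x\<close>
  transcendental over \<open>K\<close>.\<close>

locale function_field =
  fixes \<kappa> :: "'k::field \<Rightarrow> 'f::field"
  assumes const_one: "\<kappa> 1 = 1"
    and const_add: "\<kappa> (a + b) = \<kappa> a + \<kappa> b"
    and const_mult: "\<kappa> (a * b) = \<kappa> a * \<kappa> b"
    and finite_over_rational:
      "\<exists>x. transcendental_over \<kappa> x \<and>
         (\<exists>B. finite B \<and>
            (\<forall>y. \<exists>c. (\<forall>b\<in>B. c b \<in> simple_ext \<kappa> x) \<and> y = (\<Sum>b\<in>B. c b * b)))"

definition full_constant_field :: "('k::field \<Rightarrow> 'f::field) \<Rightarrow> bool" where
  "full_constant_field \<kappa> \<longleftrightarrow> (\<forall>y. \<not> transcendental_over \<kappa> y \<longrightarrow> y \<in> range \<kappa>)"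

text \<open>This makes \<open>vector_space.dim (\<lambda>c y. \<kappa> c * y)\<close> the dimension over the constant field.\<close>

lemma (in function_field) vector_space_over_constants: "vector_space (\<lambda>c y. \<kappa> c * y)"
  by unfold_locales (simp_all add: const_one const_add const_mult algebra_simps)


section \<open>Places\<close>

definition valuation_ring :: "('k::field \<Rightarrow> 'f::field) \<Rightarrow> 'f set \<Rightarrow> bool" where
  "valuation_ring \<kappa> R \<longleftrightarrow>
     range \<kappa> \<subset> R \<and> R \<subset> UNIV \<and>
     (\<forall>x\<in>R. \<forall>y\<in>R. x - y \<in> R \<and> x * y \<in> R) \<and>
     (\<forall>z. z \<noteq> 0 \<longrightarrow> z \<in> R \<or> inverse z \<in> R)"

definition ideal_in :: "'f::field set \<Rightarrow> 'f set \<Rightarrow> bool" where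
  "ideal_in R I \<longleftrightarrow>
     I \<subseteq> R \<and> 0 \<in> I \<and> (\<forall>x\<in>I. \<forall>y\<in>I. x + y \<in> I) \<and> (\<forall>a\<in>R. \<forall>x\<in>I. a * x \<in> I)"

definition maximal_ideal_in :: "'f::field set \<Rightarrow> 'f set \<Rightarrow> bool" where
  "maximal_ideal_in R I \<longleftrightarrow>
     ideal_in R I \<and> I \<noteq> R \<and> (\<forall>J. ideal_in R J \<and> I \<subseteq> J \<longrightarrow> J = I \<or> J = R)"

definition places :: "('k::field \<Rightarrow> 'f::field) \<Rightarrow> 'f set set" where
  "places \<kappa> = {P. \<exists>R. valuation_ring \<kappa> R \<and> maximal_ideal_in R P}"

text \<open>A place \<open>P\<close> determines its valuation ring: \<open>O\<^sub>P = {z. z\<inverse> \<notin> P}\<close>, where \<open>0\<inverse>\<close> is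
  read as \<open>\<infinity>\<close>.\<close>

definition place_ring :: "'f::field set \<Rightarrow> 'f set" where
  "place_ring P = {z. z = 0 \<or> inverse z \<notin> P}"

definition local_parameter :: "'f::field set \<Rightarrow> 'f \<Rightarrow> bool" where
  "local_parameter P t \<longleftrightarrow> P = (\<lambda>y. t * y) ` place_ring P"

text \<open>The normalised valuation \<open>v\<^sub>P\<close>: \<open>z = t\<^sup>n u\<close> with \<open>u\<close> a unit of \<open>O\<^sub>P\<close>. It is meaningful
  for \<open>z \<noteq> 0\<close> only; \<open>v\<^sub>P(0) = \<infinity>\<close> is treated separately wherever it is used.\<close>

definition val :: "'f::field set \<Rightarrow> 'f \<Rightarrow> int" where
  "val P z =
     (THE n. \<exists>t u. local_parameter P t \<and> u \<in> place_ring P \<and> u \<noteq> 0 \<and> inverse u \<in> place_ring P \<and>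
        z = t powi n * u)"

text \<open>\<open>B\<close> consists of representatives of a basis of the residue class field \<open>O\<^sub>P / P\<close>.\<close>

definition residue_basis :: "('k::field \<Rightarrow> 'f::field) \<Rightarrow> 'f set \<Rightarrow> 'f set \<Rightarrow> bool" where
  "residue_basis \<kappa> P B \<longleftrightarrow>
     finite B \<and> B \<subseteq> place_ring P \<and>
     (\<forall>y\<in>place_ring P. \<exists>!c. (\<forall>b. b \<notin> B \<longrightarrow> c b = 0) \<and> y - (\<Sum>b\<in>B. \<kappa> (c b) * b) \<in> P)"

text \<open>The dimension of \<open>O\<^sub>P / P\<close> over the constant field. As for \<open>dim\<close> and \<open>card\<close>, the value
  would be 0 if it were infinite, which does not happen for places of function fields.\<close>

definition place_degree :: "('k::field \<Rightarrow> 'f::field) \<Rightarrow> 'f set \<Rightarrow> nat" where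
  "place_degree \<kappa> P =
     (if \<exists>B. residue_basis \<kappa> P B then card (SOME B. residue_basis \<kappa> P B) else 0)"

definition rational_place :: "('k::field \<Rightarrow> 'f::field) \<Rightarrow> 'f set \<Rightarrow> bool" where
  "rational_place \<kappa> P \<longleftrightarrow> P \<in> places \<kappa> \<and> place_degree \<kappa> P = 1"

text \<open>The value \<open>f(P)\<close> of \<open>f \<in> O\<^sub>P\<close> at a rational place, as a constant.\<close>

definition eval_at :: "('k::field \<Rightarrow> 'f::field) \<Rightarrow> 'f set \<Rightarrow> 'f \<Rightarrow> 'k" where
  "eval_at \<kappa> P f = (THE c. f - \<kappa> c \<in> P)"


section \<open>Divisors and genus\<close>

text \<open>Divisors are elements of the free abelian group on the places.\<close>

definition divisors :: "('k::field \<Rightarrow> 'f::field) \<Rightarrow> ('f set \<Rightarrow>\<^sub>0 int) set" where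
  "divisors \<kappa> = {A. Poly_Mapping.keys A \<subseteq> places \<kappa>}"

definition divisor_degree :: "('k::field \<Rightarrow> 'f::field) \<Rightarrow> ('f set \<Rightarrow>\<^sub>0 int) \<Rightarrow> int" where
  "divisor_degree \<kappa> A =
     (\<Sum>P\<in>Poly_Mapping.keys A. Poly_Mapping.lookup A P * int (place_degree \<kappa> P))"

definition riemann_roch_space ::
    "('k::field \<Rightarrow> 'f::field) \<Rightarrow> ('f set \<Rightarrow>\<^sub>0 int) \<Rightarrow> 'f set" where
  "riemann_roch_space \<kappa> A =
     {h. h \<noteq> 0 \<and> (\<forall>P\<in>places \<kappa>. val P h + Poly_Mapping.lookup A P \<ge> 0)} \<union> {0}"

text \<open>The genus is the maximum of \<open>deg A - dim L(A) + 1\<close> over all divisors \<open>A\<close>.\<close>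

definition has_genus :: "('k::field \<Rightarrow> 'f::field) \<Rightarrow> int \<Rightarrow> bool" where
  "has_genus \<kappa> g \<longleftrightarrow>
     (let S = (\<lambda>A. divisor_degree \<kappa> A
                 - int (vector_space.dim (\<lambda>c y. \<kappa> c * y) (riemann_roch_space \<kappa> A)) + 1)
              ` divisors \<kappa>
      in g \<in> S \<and> (\<forall>x\<in>S. x \<le> g))"


section \<open>The Guruswami--Sudan list-decoder\<close>

text \<open>Words of length \<open>n\<close> are elements of \<open>{1..n} \<rightarrow>\<^sub>E UNIV\<close>; the evaluation places are
  \<open>P 1, \<dots>, P n\<close>.\<close>

definition eval_divisor :: "nat \<Rightarrow> (nat \<Rightarrow> 'f::field set) \<Rightarrow> ('f set \<Rightarrow>\<^sub>0 int)" where
  "eval_divisor n P = (\<Sum>i=1..n. frag_of (P i))"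

definition codeword ::
    "('k::field \<Rightarrow> 'f::field) \<Rightarrow> nat \<Rightarrow> (nat \<Rightarrow> 'f set) \<Rightarrow> 'f \<Rightarrow> (nat \<Rightarrow> 'k)" where
  "codeword \<kappa> n P f = (\<lambda>i\<in>{1..n}. eval_at \<kappa> (P i) f)"

definition hamming_dist :: "nat \<Rightarrow> (nat \<Rightarrow> 'k) \<Rightarrow> (nat \<Rightarrow> 'k) \<Rightarrow> nat" where
  "hamming_dist n v w = card {i\<in>{1..n}. v i \<noteq> w i}"

text \<open>\<open>(P, r)\<close> is a zero of \<open>Q\<close> with multiplicity at least \<open>m\<close>: writing
  \<open>Q = \<Sum>\<^sub>b d\<^sub>b (z - r)\<^sup>b\<close>, each \<open>d\<^sub>b\<close> has a power series expansion
  \<open>\<Sum>\<^sub>a c\<^sub>a\<^sub>b \<phi>\<^sup>a\<close> at \<open>P\<close>, i.e. its partial sums below \<open>N\<close> agree with \<open>d\<^sub>b\<close> to order at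
  least \<open>N\<close>, and \<open>c\<^sub>a\<^sub>b = 0\<close> whenever \<open>a + b < m\<close>.\<close>

definition zero_of_mult ::
    "('k::field \<Rightarrow> 'f::field) \<Rightarrow> 'f set \<Rightarrow> 'k \<Rightarrow> 'f poly \<Rightarrow> nat \<Rightarrow> bool" where
  "zero_of_mult \<kappa> P r Q m \<longleftrightarrow>
     (\<exists>\<phi> c d. local_parameter P \<phi> \<and>
        Q = (\<Sum>b\<le>degree Q. smult (d b) ([:- \<kappa> r, 1:] ^ b)) \<and>
        (\<forall>b\<le>degree Q. \<forall>N::nat.
           let rest = d b - (\<Sum>a<N. \<kappa> (c a b) * \<phi> ^ a) in rest = 0 \<or> val P rest \<ge> int N) \<and>
        (\<forall>a b. a + b < m \<longrightarrow> c a b = 0))"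

definition gs_interpolant ::
    "('k::field \<Rightarrow> 'f::field) \<Rightarrow> nat \<Rightarrow> (nat \<Rightarrow> 'f set) \<Rightarrow> ('f set \<Rightarrow>\<^sub>0 int) \<Rightarrow> nat \<Rightarrow> nat \<Rightarrow>
     ('f set \<Rightarrow>\<^sub>0 int) \<Rightarrow> (nat \<Rightarrow> 'k) \<Rightarrow> 'f poly \<Rightarrow> bool" where
  "gs_interpolant \<kappa> n P G s l A r Q \<longleftrightarrow>
     Q \<noteq> 0 \<and> degree Q \<le> l \<and>
     (\<forall>j\<le>l. coeff Q j \<in> riemann_roch_space \<kappa> (A - frag_cmul (int j) G)) \<and>
     (\<forall>i\<in>{1..n}. zero_of_mult \<kappa> (P i) (r i) Q s)"

text \<open>The decoder is free to choose the interpolant, so its output is described by a relation: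
  \<open>S\<close> is a possible output on input \<open>r\<close>, with target \<open>\<tau>\<close> and auxiliary divisor \<open>A\<close>.\<close>

definition gs_output ::
    "('k::field \<Rightarrow> 'f::field) \<Rightarrow> nat \<Rightarrow> (nat \<Rightarrow> 'f set) \<Rightarrow> ('f set \<Rightarrow>\<^sub>0 int) \<Rightarrow> nat \<Rightarrow> nat \<Rightarrow>
     nat \<Rightarrow> ('f set \<Rightarrow>\<^sub>0 int) \<Rightarrow> (nat \<Rightarrow> 'k) \<Rightarrow> 'f set \<Rightarrow> bool" where
  "gs_output \<kappa> n P G s l \<tau> A r S \<longleftrightarrow>
     (\<exists>Q. gs_interpolant \<kappa> n P G s l A r Q \<and>
        S = {f \<in> riemann_roch_space \<kappa> G. poly Q f = 0 \<and> hamming_dist n (codeword \<kappa> n P f) r \<le> \<tau>}) \<or>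
     (\<nexists>Q. gs_interpolant \<kappa> n P G s l A r Q) \<and> S = {}"

definition gs_admissible_divisor ::
    "('k::field \<Rightarrow> 'f::field) \<Rightarrow> nat \<Rightarrow> (nat \<Rightarrow> 'f set) \<Rightarrow> nat \<Rightarrow> nat \<Rightarrow> ('f set \<Rightarrow>\<^sub>0 int) \<Rightarrow> bool"
  where
  "gs_admissible_divisor \<kappa> n P s \<tau> A \<longleftrightarrow>
     A \<in> divisors \<kappa> \<and>
     Poly_Mapping.keys A \<inter> Poly_Mapping.keys (eval_divisor n P) = {} \<and>
     divisor_degree \<kappa> A = int s * (int n - int \<tau>) - 1"

definition gs_radius_at_least ::
    "('k::field \<Rightarrow> 'f::field) \<Rightarrow> nat \<Rightarrow> (nat \<Rightarrow> 'f set) \<Rightarrow> ('f set \<Rightarrow>\<^sub>0 int) \<Rightarrow> nat \<Rightarrow> nat \<Rightarrow>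
     real \<Rightarrow> bool" where
  "gs_radius_at_least \<kappa> n P G s l X \<longleftrightarrow>
     (\<forall>\<tau>::nat. \<tau> \<le> n \<and> real \<tau> \<le> X \<longrightarrow>
        (\<forall>r \<in> {1..n} \<rightarrow>\<^sub>E UNIV.
           (let C = {f \<in> riemann_roch_space \<kappa> G. hamming_dist n (codeword \<kappa> n P f) r \<le> \<tau>}
            in finite C \<and> card C \<le> l \<and>
               (\<forall>A S. gs_admissible_divisor \<kappa> n P s \<tau> A \<and> gs_output \<kappa> n P G s l \<tau> A r S
                  \<longrightarrow> S = C))))"

end

theory Submission
  imports Defs "HOL-Library.Cardinality"
begin

text \<open>
  For a given \<open>f\<close> close to \<open>r\<close>, look for an interpolation polynomial of the form
  \<open>Q = \<Sum>\<^sub>j\<^sub>\<ge>\<^sub>1 q\<^sub>j (z - f)\<^sup>j\<close>. Compared with counting over all \<open>Q\<close>, this saves one application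
  of Riemann's inequality, and every place where \<open>f\<close> agrees with \<open>r\<close> costs only \<open>s (s - 1) / 2\<close>
  conditions; within the stated radius an interpolation polynomial therefore exists whenever
  there is anything to decode. Conversely, for any such \<open>Q\<close> and any \<open>f\<close> close to \<open>r\<close>, the
  element \<open>Q(f)\<close> lies in \<open>L(A - s \<Sum> P\<^sub>i)\<close>, the sum being over the places of agreement. This
  divisor has negative degree, so \<open>Q(f) = 0\<close>.

  The constant field is finite, so the linear algebra can be replaced by the pigeonhole
  principle.
\<close>

section \<open>Polynomial relations\<close>

text \<open>Twice the number of conditions is \<open>n * s * (s - 1)\<close> plus
  \<open>2 * s\<close> per disagreement; twice the number of unknowns is at least
  \<open>2 * l * (s * (n - \<tau>) - g) - l * (l + 1) * deg G\<close>. Both are even, so asking for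
  strictly more unknowns is what the \<open>- 2\<close> in the radius expresses. The count over all
  \<open>Q\<close> has the same main terms but \<open>l + 1\<close> copies of \<open>g\<close>
  instead of \<open>l\<close>; this turns \<open>g / s\<close> into
  \<open>l / (l + 1) * g / s\<close>. That the form of \<open>Q\<close> depends on the unknown
  \<open>f\<close> is harmless: only existence is drawn from it, and any interpolation polynomial
  has every close \<open>f\<close> as a root.

  The main burden is the function field theory behind this, since places are given only as maximal
  ideals of valuation rings and the genus only as a maximum. Discreteness of the valuations is
  extracted from a bound on the number of elements independent over \<open>K(x)\<close>. That
  \<open>L(A) = {0}\<close> in negative degree comes from Riemann's inequality, which is built into
  the definition of the genus, and from the existence of poles, obtained by extending rings as in
  Chevalley's theorem.\<close>

locale finite_function_field = function_field \<kappa>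
  for \<kappa> :: "'k::{field,finite} \<Rightarrow> 'f::field"
begin

section \<open>The constants as a subfield, and evaluation of polynomials over them\<close>

lemma const_zero [simp]: "\<kappa> 0 = 0"
proof -
  have "\<kappa> 0 + \<kappa> 0 = \<kappa> 0 + 0"
    using const_add[of 0 0] by simp
  then show ?thesis
    by (simp only: add_left_cancel)
qed

lemma const_minus: "\<kappa> (- a) = - \<kappa> a"
  using const_add[of a "- a"] by (simp add: eq_neg_iff_add_eq_0 add.commute)

lemma const_diff: "\<kappa> (a - b) = \<kappa> a - \<kappa> b"
  using const_add[of a "- b"] by (simp add: const_minus)

lemma const_eq_0_iff [simp]: "\<kappa> a = 0 \<longleftrightarrow> a = 0"
  using const_mult[of a "inverse a"] const_one by (cases "a = 0") auto

lemma const_inverse: "\<kappa> (inverse a) = inverse (\<kappa> a)"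
proof (cases "a = 0")
  case False
  then have "\<kappa> a * \<kappa> (inverse a) = 1"
    using const_mult[of a "inverse a"] const_one by simp
  then show ?thesis
    by (simp add: inverse_unique)
qed simp

lemma const_eq_iff [simp]: "\<kappa> a = \<kappa> b \<longleftrightarrow> a = b"
  using const_eq_0_iff[of "a - b"] by (simp add: const_diff)

lemma card_field_gt_1: "CARD('k) > 1"
  using card_mono[of "UNIV :: 'k set" "{0, 1}"] by simp

abbreviation ev :: "'f \<Rightarrow> 'k poly \<Rightarrow> 'f" where
  "ev x p \<equiv> poly (map_poly \<kappa> p) x"

lemma ev_pCons [simp]: "ev x (pCons a p) = \<kappa> a + x * ev x p"
  by (simp add: map_poly_pCons)

lemma ev_add: "ev x (p + q) = ev x p + ev x q"
  by (induction p q rule: poly_induct2) (simp_all add: const_add algebra_simps)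

lemma ev_smult: "ev x (smult a p) = \<kappa> a * ev x p"
  by (induction p) (simp_all add: const_mult algebra_simps)

lemma ev_mult: "ev x (p * q) = ev x p * ev x q"
  by (induction p) (simp_all add: ev_add ev_smult algebra_simps)

lemma ev_one [simp]: "ev x 1 = 1"
  by (simp add: const_one map_poly_1)

lemma ev_power: "ev x (p ^ m) = ev x p ^ m"
  by (induction m) (simp_all add: ev_mult)

lemma ev_monom: "ev x (monom a i) = \<kappa> a * x ^ i"
  by (simp add: map_poly_monom poly_monom)

lemma ev_sum: "ev x (\<Sum>i\<in>I. p i) = (\<Sum>i\<in>I. ev x (p i))"
  by (induction I rule: infinite_finite_induct) (simp_all add: ev_add)

lemma ev_eq_sum:
  assumes "degree p \<le> k"
  shows "ev x p = (\<Sum>i\<le>k. \<kappa> (coeff p i) * x ^ i)"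
  using poly_as_sum_of_monoms'[OF assms]
    ev_sum[where I = "{..k}" and x = x and p = "\<lambda>i. monom (coeff p i) i"]
  by (simp add: ev_monom)

lemma transcendental_over_iff: "transcendental_over \<kappa> x \<longleftrightarrow> (\<forall>p. p \<noteq> 0 \<longrightarrow> ev x p \<noteq> 0)"
  by (simp add: transcendental_over_def)

text \<open>Plays the role of a finite-dimensional space over the constants. Since \<open>B\<close>
  merely spans, its size is only bounded from above, which is the direction that the pigeonhole
  principle uses.\<close>

definition poly_combs :: "'f \<Rightarrow> 'f set \<Rightarrow> nat \<Rightarrow> 'f set" where
  "poly_combs x B k = {\<Sum>b\<in>B. ev x (p b) * b | p. \<forall>b\<in>B. degree (p b) \<le> k}"

lemma poly_combs_zero: "0 \<in> poly_combs x B k"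
  unfolding poly_combs_def by (force intro: exI[of _ "\<lambda>_. 0"])

lemma poly_combs_add:
  assumes "u \<in> poly_combs x B k" "v \<in> poly_combs x B k"
  shows "u + v \<in> poly_combs x B k"
proof -
  obtain p where p: "u = (\<Sum>b\<in>B. ev x (p b) * b)" "\<forall>b\<in>B. degree (p b) \<le> k"
    using assms(1) by (auto simp: poly_combs_def)
  obtain q where q: "v = (\<Sum>b\<in>B. ev x (q b) * b)" "\<forall>b\<in>B. degree (q b) \<le> k"
    using assms(2) by (auto simp: poly_combs_def)
  have "u + v = (\<Sum>b\<in>B. ev x (p b + q b) * b)"
    by (simp add: p(1) q(1) ev_add algebra_simps sum.distrib)
  then show ?thesis
    unfolding poly_combs_def using p(2) q(2)
    by (auto intro!: exI[of _ "\<lambda>b. p b + q b"] degree_add_le)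
qed

lemma poly_combs_sum:
  "(\<And>i. i \<in> I \<Longrightarrow> u i \<in> poly_combs x B k) \<Longrightarrow> (\<Sum>i\<in>I. u i) \<in> poly_combs x B k"
  by (induction I rule: infinite_finite_induct) (auto intro: poly_combs_zero poly_combs_add)

lemma poly_combs_mult:
  assumes "u \<in> poly_combs x B k" and "k + degree q \<le> k'"
  shows "ev x q * u \<in> poly_combs x B k'"
proof -
  obtain p where p: "u = (\<Sum>b\<in>B. ev x (p b) * b)" "\<forall>b\<in>B. degree (p b) \<le> k"
    using assms(1) by (auto simp: poly_combs_def)
  have "ev x q * u = (\<Sum>b\<in>B. ev x (q * p b) * b)"
    by (simp add: p(1) ev_mult algebra_simps sum_distrib_left)
  moreover have "degree (q * p b) \<le> k'" if "b \<in> B" for b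
    using degree_mult_le[of q "p b"] p(2) that assms(2) by force
  ultimately show ?thesis
    unfolding poly_combs_def by (auto intro!: exI[of _ "\<lambda>b. q * p b"])
qed

lemma poly_combs_generator:
  assumes "finite B" "b \<in> B"
  shows "b \<in> poly_combs x B 0"
proof -
  have "b = (\<Sum>b'\<in>B. ev x (if b' = b then 1 else 0) * b')"
    using assms by (simp add: if_distrib[of "ev x"] if_distrib[of "\<lambda>u. u * _"] cong: if_cong)
  then show ?thesis
    unfolding poly_combs_def by (force intro: exI[of _ "\<lambda>b'. if b' = b then 1 else 0"])
qed

lemma poly_combs_finite_card:
  assumes "finite B"
  shows "finite (poly_combs x B k)"
    and "card (poly_combs x B k) \<le> CARD('k) ^ (card B * (k + 1))"
proof -
  let ?C = "B \<times> {..k} \<rightarrow>\<^sub>E (UNIV :: 'k set)"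
  let ?h = "\<lambda>c. \<Sum>b\<in>B. (\<Sum>i\<le>k. \<kappa> (c (b, i)) * x ^ i) * b"
  have sub: "poly_combs x B k \<subseteq> ?h ` ?C"
  proof
    fix u assume "u \<in> poly_combs x B k"
    then obtain p where p: "u = (\<Sum>b\<in>B. ev x (p b) * b)" "\<forall>b\<in>B. degree (p b) \<le> k"
      by (auto simp: poly_combs_def)
    define c where "c = restrict (\<lambda>(b, i). coeff (p b) i) (B \<times> {..k})"
    have "u = ?h c"
      using p by (auto simp: c_def ev_eq_sum intro!: sum.cong)
    moreover have "c \<in> ?C"
      by (auto simp: c_def)
    ultimately show "u \<in> ?h ` ?C" by blast
  qed
  have fin: "finite ?C"
    using assms by (intro finite_PiE) auto
  show "finite (poly_combs x B k)"
    using sub fin finite_surj by blast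
  have "card (poly_combs x B k) \<le> card ?C"
    using sub fin by (meson card_image_le card_mono finite_imageI le_trans)
  also have "card ?C = CARD('k) ^ (card B * (k + 1))"
    using assms by (simp add: card_PiE)
  finally show "card (poly_combs x B k) \<le> CARD('k) ^ (card B * (k + 1))" .
qed

text \<open>Spanning is over the field \<open>K(x)\<close>, whereas counting requires coefficients
  in \<open>K[x]\<close> of bounded degree. For finitely many elements one denominator and one
  degree bound suffice.\<close>

lemma common_denominator:
  assumes "finite B" and span: "\<And>y. \<exists>c. (\<forall>b\<in>B. c b \<in> simple_ext \<kappa> x) \<and> y = (\<Sum>b\<in>B. c b * b)"
    and "finite Y"
  shows "\<exists>q k. ev x q \<noteq> 0 \<and> (\<forall>y\<in>Y. ev x q * y \<in> poly_combs x B k)"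
proof -
  have closed: "\<exists>q k. ev x q \<noteq> 0 \<and> ev x q * (\<Sum>b\<in>S. c b * b) \<in> poly_combs x B k"
    if c: "\<forall>b\<in>B. c b \<in> simple_ext \<kappa> x" and S: "finite S" "S \<subseteq> B" for c S
    using S
  proof (induction S rule: finite_induct)
    case empty
    then show ?case
      by (auto intro!: exI[of _ 1] poly_combs_zero)
  next
    case (insert b S)
    obtain q k where q: "ev x q \<noteq> 0" "ev x q * (\<Sum>b\<in>S. c b * b) \<in> poly_combs x B k"
      using insert by auto
    obtain p r where pr: "c b = ev x p / ev x r" "ev x r \<noteq> 0"
      using c insert.prems by (auto simp: simple_ext_def)
    define k' where "k' = k + degree r + degree (q * p)"
    have "ev x r * (ev x q * (\<Sum>b\<in>S. c b * b)) \<in> poly_combs x B k'"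
      using q(2) by (rule poly_combs_mult) (simp add: k'_def)
    moreover have "ev x (q * p) * b \<in> poly_combs x B k'"
      using insert.prems poly_combs_generator[OF \<open>finite B\<close>]
      by (intro poly_combs_mult[where k = 0]) (auto simp: k'_def)
    moreover have "ev x (q * r) * (\<Sum>b\<in>insert b S. c b * b)
        = ev x r * (ev x q * (\<Sum>b\<in>S. c b * b)) + ev x (q * p) * b"
      using insert.hyps pr by (simp add: ev_mult field_simps)
    ultimately have "ev x (q * r) * (\<Sum>b\<in>insert b S. c b * b) \<in> poly_combs x B k'"
      by (simp add: poly_combs_add)
    moreover have "ev x (q * r) \<noteq> 0"
      using q pr by (simp add: ev_mult)
    ultimately show ?case by blast
  qed
  have single: "\<exists>q k. ev x q \<noteq> 0 \<and> ev x q * y \<in> poly_combs x B k" for y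
    using span[of y] closed[of _ B] \<open>finite B\<close> by (metis order_refl)
  show ?thesis
    using \<open>finite Y\<close>
  proof (induction Y rule: finite_induct)
    case empty
    then show ?case
      by (auto intro!: exI[of _ 1])
  next
    case (insert y Y)
    obtain q k where q: "ev x q \<noteq> 0" "\<And>z. z \<in> Y \<Longrightarrow> ev x q * z \<in> poly_combs x B k"
      using insert by auto
    obtain r m where r: "ev x r \<noteq> 0" "ev x r * y \<in> poly_combs x B m"
      using single by blast
    define k' where "k' = k + m + degree q + degree r"
    have "ev x (q * r) * z \<in> poly_combs x B k'" if "z \<in> insert y Y" for z
    proof (cases "z = y")
      case True
      have "ev x q * (ev x r * y) \<in> poly_combs x B k'"
        using r(2) by (rule poly_combs_mult) (simp add: k'_def)
      then show ?thesis
        using True by (simp add: ev_mult mult.assoc)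
    next
      case False
      then have "ev x r * (ev x q * z) \<in> poly_combs x B k'"
        using that by (intro poly_combs_mult[OF q(2)]) (auto simp: k'_def)
      then show ?thesis
        by (simp add: ev_mult ac_simps)
    qed
    moreover have "ev x (q * r) \<noteq> 0"
      using q r by (simp add: ev_mult)
    ultimately show ?case by blast
  qed
qed

text \<open>The field is finite over \<open>K(x)\<close> for every transcendental \<open>x\<close>. Counting replaces linear
  algebra: with \<open>x\<^sub>0\<close> and \<open>B\<close> as in the definition of a function field, the products
  \<open>x\<^sup>i y\<^sub>j\<close> with \<open>i < M\<close> have, up to a common denominator, coefficients of degree
  \<open>D M + O(1)\<close> in \<open>x\<^sub>0\<close>, so that \<open>N > D |B|\<close> elements \<open>y\<^sub>j\<close> have more combinations than
  there is room for.\<close>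

lemma polynomial_relation:
  "\<exists>N. \<forall>y :: nat \<Rightarrow> 'f. \<exists>\<phi>. (\<exists>j<N. \<phi> j \<noteq> 0) \<and> (\<Sum>j<N. ev x (\<phi> j) * y j) = 0"
proof -
  obtain x0 B where B: "finite B"
    and span: "\<And>y. \<exists>c. (\<forall>b\<in>B. c b \<in> simple_ext \<kappa> x0) \<and> y = (\<Sum>b\<in>B. c b * b)"
    using finite_over_rational by metis
  obtain q k0 where q: "ev x0 q \<noteq> 0" "\<And>b. b \<in> B \<Longrightarrow> ev x0 q * (x * b) \<in> poly_combs x0 B k0"
    using common_denominator[OF B span, of "(\<lambda>b. x * b) ` B"] B by auto
  define D where "D = k0 + degree q"
  \<comment> \<open>\<open>q\<close> clears the denominators of multiplication by \<open>x\<close>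
    on \<open>B\<close>, so one factor \<open>x\<close> costs one factor \<open>q\<close> and at
    most \<open>D\<close> degrees.\<close>
  have step: "ev x0 q * x * u \<in> poly_combs x0 B (m + D)" if u: "u \<in> poly_combs x0 B m" for u m
  proof -
    obtain p where p: "u = (\<Sum>b\<in>B. ev x0 (p b) * b)" "\<forall>b\<in>B. degree (p b) \<le> m"
      using u by (auto simp: poly_combs_def)
    have "ev x0 q * x * u = (\<Sum>b\<in>B. ev x0 (p b) * (ev x0 q * (x * b)))"
      by (simp add: p(1) sum_distrib_left ac_simps)
    also have "\<dots> \<in> poly_combs x0 B (m + D)"
      using p(2) by (intro poly_combs_sum poly_combs_mult[OF q(2)]) (auto simp: D_def)
    finally show ?thesis .
  qed
  have steps: "(ev x0 q * x) ^ i * u \<in> poly_combs x0 B (m + i * D)"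
    if u: "u \<in> poly_combs x0 B m" for u m i
  proof (induction i)
    case (Suc i)
    show ?case
      using step[OF Suc] by (simp add: ac_simps)
  qed (use u in simp)
  define N where "N = card B * D + 1"
  have "\<exists>\<phi>. (\<exists>j<N. \<phi> j \<noteq> 0) \<and> (\<Sum>j<N. ev x (\<phi> j) * y j) = 0" for y :: "nat \<Rightarrow> 'f"
  proof -
    obtain p k where p: "ev x0 p \<noteq> 0" "\<And>j. j < N \<Longrightarrow> ev x0 p * y j \<in> poly_combs x0 B k"
      using common_denominator[OF B span, of "y ` {..<N}"] by auto
    \<comment> \<open>Chosen so that
      \<open>N * M - card B * (k + M * D + 1) = M - card B * (k + 1) = 1\<close>, which leaves more
      coefficient families than values.\<close>
    define M where "M = card B * (k + 1) + 1"
    define T where "T = poly_combs x0 B (k + M * D)"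
    define C where "C = {..<N} \<times> {..<M} \<rightarrow>\<^sub>E (UNIV :: 'k set)"
    define h where "h = (\<lambda>c. \<Sum>j<N. \<Sum>i<M. \<kappa> (c (j, i)) * x ^ i * y j)"
    \<comment> \<open>\<open>x ^ i\<close> requires only \<open>q ^ i\<close>; the exponent
      \<open>M\<close> gives all monomials the same denominator, and the padding
      \<open>q ^ (M - i)\<close> still fits the degree bound because
      \<open>degree q \<le> D\<close>.\<close>
    define d where "d = ev x0 p * ev x0 q ^ M"
    have "d * (x ^ i * y j) \<in> T" if "j < N" "i < M" for i j
    proof -
      have "(ev x0 q * x) ^ i * (ev x0 p * y j) \<in> poly_combs x0 B (k + i * D)"
        using steps p(2) that by blast
      moreover have "k + i * D + degree (q ^ (M - i)) \<le> k + M * D"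
      proof -
        have "degree (q ^ (M - i)) \<le> degree q * (M - i)"
          by (rule degree_power_le)
        also have "\<dots> \<le> (M - i) * D"
          by (simp add: D_def mult.commute)
        finally have "degree (q ^ (M - i)) \<le> (M - i) * D" .
        moreover have "M * D = i * D + (M - i) * D"
          using that by (simp flip: add_mult_distrib)
        ultimately show ?thesis by simp
      qed
      ultimately have "ev x0 (q ^ (M - i)) * ((ev x0 q * x) ^ i * (ev x0 p * y j)) \<in> T"
        unfolding T_def by (rule poly_combs_mult)
      moreover have "ev x0 q ^ M = ev x0 q ^ (M - i) * ev x0 q ^ i"
        using that by (simp flip: power_add)
      ultimately show ?thesis
        by (simp add: d_def ev_power power_mult_distrib ac_simps)
    qed
    note monomial = this
    have "d * h c \<in> T" for c
    proof -
      have "d * h c = (\<Sum>j<N. \<Sum>i<M. ev x0 [:c (j, i):] * (d * (x ^ i * y j)))"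
        by (simp add: h_def sum_distrib_left ac_simps)
      also have "\<dots> \<in> T"
        unfolding T_def
        by (intro poly_combs_sum poly_combs_mult[OF monomial[unfolded T_def]]) auto
      finally show ?thesis .
    qed
    then have "(\<lambda>c. d * h c) ` C \<subseteq> T" by blast
    moreover have "finite T" "card T < card C"
    proof -
      show "finite T"
        unfolding T_def using B by (rule poly_combs_finite_card)
      have "card T \<le> CARD('k) ^ (card B * (k + M * D + 1))"
        unfolding T_def using B by (rule poly_combs_finite_card)
      also have "\<dots> < CARD('k) ^ (N * M)"
        using card_field_gt_1
        by (intro power_strict_increasing) (auto simp: N_def M_def algebra_simps)
      also have "\<dots> = card C"
        by (simp add: C_def card_PiE)
      finally show "card T < card C" .
    qed
    ultimately have "\<not> inj_on (\<lambda>c. d * h c) C"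
      using card_inj_on_le by (metis not_le)
    then obtain c c' where c: "c \<in> C" "c' \<in> C" "c \<noteq> c'" "d * h c = d * h c'"
      by (auto simp: inj_on_def)
    define \<phi> where "\<phi> j = (\<Sum>i<M. monom (c (j, i) - c' (j, i)) i)" for j
    obtain j i where ji: "j < N" "i < M" "c (j, i) \<noteq> c' (j, i)"
    proof -
      obtain a where "c a \<noteq> c' a" "a \<in> {..<N} \<times> {..<M}"
        using c(1-3) PiE_ext[of c "{..<N} \<times> {..<M}" "\<lambda>_. UNIV" c'] by (auto simp: C_def)
      then show ?thesis
        using that by (cases a) auto
    qed
    have "coeff (\<phi> j) i = c (j, i) - c' (j, i)"
      using ji(2) by (simp add: \<phi>_def coeff_sum)
    then have "\<phi> j \<noteq> 0"
      using ji(3) by auto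
    moreover have "h c = h c'"
      using c(4) p(1) q(1) by (simp add: d_def)
    then have "(\<Sum>j<N. ev x (\<phi> j) * y j) = 0"
      by (simp add: \<phi>_def h_def ev_sum ev_monom const_diff sum_distrib_right sum_subtractf
          left_diff_distrib)
    ultimately show ?thesis
      using ji(1) by blast
  qed
  then show ?thesis by blast
qed

text \<open>If all constant terms vanish, cancelling one factor \<open>x\<close> lowers the degrees.
  A constant term is what survives modulo a place at which \<open>x\<close> vanishes.\<close>

lemma relation_with_constant_term:
  fixes N :: nat
  assumes "x \<noteq> 0" and "\<exists>j<N. \<phi> j \<noteq> 0" and "(\<Sum>j<N. ev x (\<phi> j) * y j) = 0"
  shows "\<exists>\<psi>. (\<exists>j<N. coeff (\<psi> j) 0 \<noteq> 0) \<and> (\<Sum>j<N. ev x (\<psi> j) * y j) = 0"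
proof -
  have "\<exists>\<psi>. (\<exists>j<N. coeff (\<psi> j) 0 \<noteq> 0) \<and> (\<Sum>j<N. ev x (\<psi> j) * y j) = 0"
    if "\<forall>j<N. degree (\<phi> j) \<le> M" "\<exists>j<N. \<phi> j \<noteq> 0" "(\<Sum>j<N. ev x (\<phi> j) * y j) = 0" for M \<phi>
    using that
  proof (induction M arbitrary: \<phi>)
    case 0
    have "coeff (\<phi> j) 0 \<noteq> 0" if "j < N" "\<phi> j \<noteq> 0" for j
    proof -
      have "degree (\<phi> j) = 0"
        using 0(1) that(1) by simp
      with leading_coeff_neq_0[OF that(2)] show ?thesis
        by (simp only: not_False_eq_True)
    qed
    then show ?case
      using 0(2,3) by blast
  next
    case (Suc M)
    show ?case
    proof (cases "\<exists>j<N. coeff (\<phi> j) 0 \<noteq> 0")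
      case True
      with Suc.prems show ?thesis by blast
    next
      case False
      have "\<exists>\<psi>. \<phi> j = pCons 0 \<psi>" if "j < N" for j
        using False that by (cases "\<phi> j") auto
      then obtain \<psi> where \<psi>: "\<And>j. j < N \<Longrightarrow> \<phi> j = pCons 0 (\<psi> j)"
        by metis
      have "\<forall>j<N. degree (\<psi> j) \<le> M"
        using Suc.prems(1) \<psi> by (auto simp: degree_pCons_eq_if split: if_splits)
      moreover have "\<exists>j<N. \<psi> j \<noteq> 0"
        using Suc.prems(2) \<psi> by auto
      moreover have "x * (\<Sum>j<N. ev x (\<psi> j) * y j) = 0"
        using Suc.prems(3) \<psi> by (simp add: sum_distrib_left mult.assoc)
      then have "(\<Sum>j<N. ev x (\<psi> j) * y j) = 0"
        using assms(1) by simp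
      ultimately show ?thesis
        using Suc.IH by blast
    qed
  qed
  moreover have "\<forall>j<N. degree (\<phi> j) \<le> (\<Sum>j<N. degree (\<phi> j))"
    by (intro allI impI member_le_sum) auto
  ultimately show ?thesis
    using assms(2,3) by blast
qed

end

section \<open>Places are discrete valuations\<close>

text \<open>\<open>0\<close> is listed separately because \<open>inverse 0 = 0\<close> lies in the
  ring.\<close>

definition nonunits :: "'a::field set \<Rightarrow> 'a set" where
  "nonunits R = {x \<in> R. x = 0 \<or> inverse x \<notin> R}"

text \<open>Encodes \<open>v(0) = \<infinity>\<close>, so that sums, products and shifts can be
  treated uniformly, zero included.\<close>

definition val_ge :: "'a::field set \<Rightarrow> int \<Rightarrow> 'a \<Rightarrow> bool" where
  "val_ge P m x \<longleftrightarrow> x = 0 \<or> val P x \<ge> m"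

lemma val_ge_zero [simp]: "val_ge P m 0"
  by (simp add: val_ge_def)

lemma val_ge_mono: "val_ge P m x \<Longrightarrow> k \<le> m \<Longrightarrow> val_ge P k x"
  by (auto simp: val_ge_def)

context finite_function_field
begin

section \<open>Valuation rings are local\<close>

lemma valuation_ring_closed:
  assumes "valuation_ring \<kappa> R"
  shows "\<kappa> c \<in> R" and "0 \<in> R" and "1 \<in> R"
    and "x \<in> R \<Longrightarrow> y \<in> R \<Longrightarrow> x - y \<in> R"
    and "x \<in> R \<Longrightarrow> - x \<in> R"
    and "x \<in> R \<Longrightarrow> y \<in> R \<Longrightarrow> x + y \<in> R"
    and "x \<in> R \<Longrightarrow> y \<in> R \<Longrightarrow> x * y \<in> R"
    and "z \<noteq> 0 \<Longrightarrow> z \<in> R \<or> inverse z \<in> R"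
proof -
  show const: "\<kappa> c \<in> R" for c
    using assms by (auto simp: valuation_ring_def)
  show zero: "0 \<in> R" and "1 \<in> R"
    using const[of 0] const[of 1] by (simp_all add: const_one)
  show diff: "x - y \<in> R" if "x \<in> R" "y \<in> R" for x y
    using assms that by (auto simp: valuation_ring_def)
  show minus: "- x \<in> R" if "x \<in> R" for x
    using diff[OF zero that] by simp
  show "x + y \<in> R" if "x \<in> R" "y \<in> R" for x y
    using diff[OF that(1) minus[OF that(2)]] by simp
  show "x * y \<in> R" if "x \<in> R" "y \<in> R" for x y
    using assms that by (auto simp: valuation_ring_def)
  show "z \<in> R \<or> inverse z \<in> R" if "z \<noteq> 0" for z
    using assms that by (auto simp: valuation_ring_def)
qed

text \<open>Of two nonunits one divides the other in \<open>R\<close>, so their sum is a multiple of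
  a nonunit; this gives closure under addition. An ideal containing more than the nonunits contains
  a unit, hence 1.\<close>

lemma maximal_ideal_nonunits:
  assumes R: "valuation_ring \<kappa> R"
  shows "maximal_ideal_in R (nonunits R)"
proof -
  note closed = valuation_ring_closed[OF R]
  have add: "x + y \<in> nonunits R"
    if x: "x \<in> nonunits R" and y: "y \<in> nonunits R" and xy: "y = 0 \<or> x / y \<in> R" for x y
  proof (rule ccontr)
    assume "x + y \<notin> nonunits R"
    then have *: "x + y \<noteq> 0" "inverse (x + y) \<in> R"
      using x y closed(6)[of x y] by (auto simp: nonunits_def)
    then have "y \<noteq> 0"
      using x by (auto simp: nonunits_def)
    then have "x / y \<in> R"
      using xy by blast
    then have "(x / y + 1) * inverse (x + y) \<in> R"
      by (intro closed(7) closed(6) closed(3) *)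
    moreover have "(x / y + 1) * inverse (x + y) = inverse y"
      using * \<open>y \<noteq> 0\<close> by (simp add: divide_simps)
    ultimately show False
      using y \<open>y \<noteq> 0\<close> by (auto simp: nonunits_def)
  qed
  have "x + y \<in> nonunits R" if "x \<in> nonunits R" "y \<in> nonunits R" for x y
  proof (cases "y = 0 \<or> x / y \<in> R")
    case True
    then show ?thesis using add that by blast
  next
    case False
    then have "x = 0 \<or> y / x \<in> R"
      using closed(8)[of "x / y"] by auto
    then have "y + x \<in> nonunits R"
      using add that by blast
    then show ?thesis by (simp add: add.commute)
  qed
  moreover have "a * x \<in> nonunits R" if "a \<in> R" "x \<in> nonunits R" for a x
  proof (rule ccontr)
    assume "a * x \<notin> nonunits R"
    then have *: "a * x \<noteq> 0" "inverse (a * x) \<in> R"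
      using that closed(7)[of a x] by (auto simp: nonunits_def)
    then have "a * inverse (a * x) \<in> R"
      using that by (intro closed(7))
    moreover have "a * inverse (a * x) = inverse x"
      using * by (simp add: field_simps)
    ultimately have "inverse x \<in> R"
      by (simp only:)
    then show False
      using that * by (auto simp: nonunits_def)
  qed
  ultimately have "ideal_in R (nonunits R)"
    using closed(2) by (auto simp: ideal_in_def nonunits_def)
  moreover have "1 \<notin> nonunits R" "1 \<in> R"
    using closed(3) by (auto simp: nonunits_def)
  then have "nonunits R \<noteq> R" by blast
  moreover have "J = nonunits R \<or> J = R" if J: "ideal_in R J" "nonunits R \<subseteq> J" for J
  proof (cases "J = nonunits R")
    case False
    then obtain x where x: "x \<in> J" "x \<notin> nonunits R"
      using J by blast
    then have "x \<noteq> 0" "inverse x \<in> R"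
      using J by (auto simp: ideal_in_def nonunits_def)
    then have "inverse x * x \<in> J"
      using J x unfolding ideal_in_def by blast
    then have "1 \<in> J"
      using \<open>x \<noteq> 0\<close> by simp
    have "a \<in> J" if "a \<in> R" for a
    proof -
      have "a * 1 \<in> J"
        using J that \<open>1 \<in> J\<close> unfolding ideal_in_def by blast
      then show ?thesis by simp
    qed
    then show ?thesis
      using J by (auto simp: ideal_in_def)
  qed simp
  ultimately show ?thesis
    by (auto simp: maximal_ideal_in_def)
qed

lemma maximal_ideal_eq_nonunits:
  assumes R: "valuation_ring \<kappa> R" and P: "maximal_ideal_in R P"
  shows "P = nonunits R"
proof -
  have "1 \<notin> P"
  proof
    assume "1 \<in> P"
    have "a \<in> P" if "a \<in> R" for a
    proof -
      have "a * 1 \<in> P"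
        using P that \<open>1 \<in> P\<close> unfolding maximal_ideal_in_def ideal_in_def by blast
      then show ?thesis by simp
    qed
    then show False
      using P by (auto simp: maximal_ideal_in_def ideal_in_def)
  qed
  have "P \<subseteq> nonunits R"
  proof
    fix x assume x: "x \<in> P"
    have "x = 0" if "inverse x \<in> R"
    proof (rule ccontr)
      assume "x \<noteq> 0"
      have "inverse x * x \<in> P"
        using P that x unfolding maximal_ideal_in_def ideal_in_def by blast
      then show False
        using \<open>x \<noteq> 0\<close> \<open>1 \<notin> P\<close> by simp
    qed
    then show "x \<in> nonunits R"
      using x P by (auto simp: nonunits_def ideal_in_def maximal_ideal_in_def)
  qed
  with P maximal_ideal_nonunits[OF R] show ?thesis
    by (auto simp: maximal_ideal_in_def)
qed

lemma place_ring_eq: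
  assumes R: "valuation_ring \<kappa> R" and P: "maximal_ideal_in R P"
  shows "place_ring P = R"
proof -
  have "z \<in> place_ring P \<longleftrightarrow> z \<in> R" for z
    using maximal_ideal_eq_nonunits[OF assms] valuation_ring_closed(2)[OF R]
      valuation_ring_closed(8)[OF R, of z]
    by (cases "z = 0") (auto simp: place_ring_def nonunits_def)
  then show ?thesis by blast
qed

end

locale function_field_place = finite_function_field \<kappa>
  for \<kappa> :: "'k::{field,finite} \<Rightarrow> 'f::field" +
  fixes P :: "'f set"
  assumes place: "P \<in> places \<kappa>"
begin

abbreviation "O\<^sub>P \<equiv> place_ring P"

lemma ring: "valuation_ring \<kappa> O\<^sub>P"
  using place place_ring_eq by (auto simp: places_def)

lemma ideal_iff: "x \<in> P \<longleftrightarrow> x \<in> O\<^sub>P \<and> (x = 0 \<or> inverse x \<notin> O\<^sub>P)"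
  using place place_ring_eq maximal_ideal_eq_nonunits by (fastforce simp: places_def nonunits_def)

lemma ideal: "ideal_in O\<^sub>P P"
  using place place_ring_eq by (auto simp: places_def maximal_ideal_in_def)

lemmas ring_closed [simp] = valuation_ring_closed(1-7)[OF ring]
lemmas ring_total = valuation_ring_closed(8)[OF ring]

lemma ring_power [simp]: "x \<in> O\<^sub>P \<Longrightarrow> x ^ m \<in> O\<^sub>P"
  by (induction m) auto

lemma ring_ev [simp]: "x \<in> O\<^sub>P \<Longrightarrow> ev x p \<in> O\<^sub>P"
  by (induction p) auto

lemma ideal_in_ring [simp]: "x \<in> P \<Longrightarrow> x \<in> O\<^sub>P"
  by (simp add: ideal_iff)

lemma ideal_closed [simp]:
  "0 \<in> P" "x \<in> P \<Longrightarrow> y \<in> P \<Longrightarrow> x + y \<in> P"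
  "a \<in> O\<^sub>P \<Longrightarrow> x \<in> P \<Longrightarrow> a * x \<in> P" "a \<in> O\<^sub>P \<Longrightarrow> x \<in> P \<Longrightarrow> x * a \<in> P"
  using ideal by (auto simp: ideal_in_def mult.commute[of x a])

lemma ideal_minus [simp]: "x \<in> P \<Longrightarrow> - x \<in> P"
  using ideal_closed(3)[of "- 1" x] ring_closed(3,5) by simp

lemma ideal_diff [simp]: "x \<in> P \<Longrightarrow> y \<in> P \<Longrightarrow> x - y \<in> P"
  using ideal_closed(2)[of x "- y"] by simp

lemma ideal_sum: "(\<And>i. i \<in> I \<Longrightarrow> f i \<in> P) \<Longrightarrow> (\<Sum>i\<in>I. f i) \<in> P"
  by (induction I rule: infinite_finite_induct) auto

lemma one_notin_ideal [simp]: "1 \<notin> P"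
  by (simp add: ideal_iff del: ideal_in_ring)

lemma const_in_ideal_iff [simp]: "\<kappa> c \<in> P \<longleftrightarrow> c = 0"
  using ideal_iff[of "\<kappa> c"] ring_closed(1)[of "inverse c"]
  by (auto simp: const_inverse simp del: ideal_in_ring)

lemma inverse_in_ideal: "z \<notin> O\<^sub>P \<Longrightarrow> inverse z \<in> P"
  using ring_total[of z] by (cases "z = 0") (auto simp: ideal_iff simp del: ideal_in_ring)

definition place_unit :: "'f \<Rightarrow> bool" where
  "place_unit u \<longleftrightarrow> u \<in> O\<^sub>P \<and> u \<noteq> 0 \<and> inverse u \<in> O\<^sub>P"

lemma place_unit_one [simp]: "place_unit 1"
  by (auto simp: place_unit_def)

lemma place_unit_mult: "place_unit u \<Longrightarrow> place_unit w \<Longrightarrow> place_unit (u * w)"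
  by (auto simp: place_unit_def)

lemma place_unit_inverse: "place_unit u \<Longrightarrow> place_unit (inverse u)"
  by (auto simp: place_unit_def)

lemma place_unit_power: "place_unit u \<Longrightarrow> place_unit (u ^ m)"
  by (induction m) (simp_all add: place_unit_mult)

lemma place_unit_power_int: "place_unit u \<Longrightarrow> place_unit (u powi m)"
  by (simp add: power_int_def place_unit_power place_unit_inverse)

lemma in_ideal_or_unit: "x \<in> O\<^sub>P \<Longrightarrow> x \<in> P \<or> place_unit x"
  by (auto simp: ideal_iff place_unit_def simp del: ideal_in_ring)

lemma not_unit_in_ideal: "x \<in> P \<Longrightarrow> \<not> place_unit x"
  by (auto simp: ideal_iff place_unit_def simp del: ideal_in_ring)

text \<open>The members of a chain of strictly increasing valuations starting from \<open>x \<in> P\<close> are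
  linearly independent over \<open>K(x)\<close>: in a polynomial relation not divisible by \<open>x\<close>, the last
  term with nonzero constant coefficient dominates.\<close>

lemma bounded_chain:
  assumes x: "x \<noteq> 0" "x \<in> P"
  shows "\<exists>N. \<forall>y. y 0 = x \<longrightarrow> (\<forall>i<N. y i \<noteq> 0 \<and> y i \<in> P) \<longrightarrow>
    \<not> (\<forall>i. Suc i < N \<longrightarrow> y i / y (Suc i) \<in> P)"
proof -
  obtain N where N: "\<forall>y :: nat \<Rightarrow> 'f. \<exists>\<phi>. (\<exists>j<N. \<phi> j \<noteq> 0) \<and> (\<Sum>j<N. ev x (\<phi> j) * y j) = 0"
    using polynomial_relation[of x] ..
  have False if y: "y 0 = x" "\<And>i. i < N \<Longrightarrow> y i \<noteq> 0" "\<And>i. i < N \<Longrightarrow> y i \<in> P"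
    and chain: "\<And>i. Suc i < N \<Longrightarrow> y i / y (Suc i) \<in> P" for y
  proof -
    obtain \<phi> where \<phi>: "\<exists>j<N. coeff (\<phi> j) 0 \<noteq> 0" "(\<Sum>j<N. ev x (\<phi> j) * y j) = 0"
      using N relation_with_constant_term[OF x(1)] by blast
    define J where "J = Max {j. j < N \<and> coeff (\<phi> j) 0 \<noteq> 0}"
    have "J \<in> {j. j < N \<and> coeff (\<phi> j) 0 \<noteq> 0}"
      unfolding J_def using \<phi>(1) by (intro Max_in) auto
    then have J: "J < N" "coeff (\<phi> J) 0 \<noteq> 0" by auto
    have J_max: "coeff (\<phi> j) 0 = 0" if "J < j" "j < N" for j
    proof (rule ccontr)
      assume "coeff (\<phi> j) 0 \<noteq> 0"
      then have "j \<le> J"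
        unfolding J_def using that by (intro Max_ge) auto
      with that show False by simp
    qed
    have quot: "y i / y j \<in> P" if "i < j" "j < N" for i j
      using that
    proof (induction j)
      case (Suc j)
      show ?case
      proof (cases "i = j")
        case False
        then have "y i / y j \<in> P" "y j / y (Suc j) \<in> P"
          using Suc chain by simp_all
        then have "(y i / y j) * (y j / y (Suc j)) \<in> P"
          using ideal_closed(3) ideal_in_ring by blast
        moreover have "(y i / y j) * (y j / y (Suc j)) = y i / y (Suc j)"
          using y(2)[of j] Suc.prems by simp
        ultimately show ?thesis
          by (simp only:)
      qed (use chain Suc.prems in auto)
    qed simp
    have xJ: "x / y J \<in> O\<^sub>P"
      using quot[of 0 J] J y(1) y(2)[of J] by (cases "J = 0") auto
    \<comment> \<open>For \<open>j < J\<close> the chain puts \<open>y j / y J\<close> in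
      \<open>P\<close>. For \<open>j > J\<close> the coefficient contains a factor \<open>x\<close>,
      and \<open>x / y J\<close> is regular because \<open>x = y 0\<close> starts the chain; the
      factor \<open>y j\<close> in \<open>P\<close> remains.\<close>
    have terms: "ev x (\<phi> j) * y j / y J \<in> P" if j: "j < N" "j \<noteq> J" for j
    proof (cases "j < J")
      case True
      then show ?thesis
        using ideal_closed(3)[of "ev x (\<phi> j)" "y j / y J"] quot J x by auto
    next
      case False
      obtain \<psi> where "\<phi> j = pCons 0 \<psi>"
        using J_max[of j] False j by (cases "\<phi> j") auto
      then have "ev x (\<phi> j) * y j / y J = ev x \<psi> * (x / y J) * y j"
        by simp
      also have "\<dots> \<in> P"
        using xJ x y(3)[of j] j by (intro ideal_closed(3) ring_closed(7) ring_ev) auto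
      finally show ?thesis .
    qed
    obtain a \<psi> where a: "\<phi> J = pCons a \<psi>" "a \<noteq> 0"
      using J by (cases "\<phi> J") auto
    have "0 = (\<Sum>j<N. ev x (\<phi> j) * y j / y J)"
      using \<phi>(2) by (simp flip: sum_divide_distrib)
    also have "\<dots> = ev x (\<phi> J) + (\<Sum>j\<in>{..<N} - {J}. ev x (\<phi> j) * y j / y J)"
      using J y(2)[of J] by (subst sum.remove[of _ J]) auto
    finally have "\<kappa> a = - (x * ev x \<psi> + (\<Sum>j\<in>{..<N} - {J}. ev x (\<phi> j) * y j / y J))"
      by (simp add: a eq_neg_iff_add_eq_0 add.assoc del: minus_add_distrib)
    also have "\<dots> \<in> P"
      using x terms by (intro ideal_minus ideal_closed ideal_sum) auto
    finally show False
      using a by simp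
  qed
  then show ?thesis by blast
qed

lemma ideal_nontrivial: "\<exists>x\<in>P. x \<noteq> 0"
proof -
  obtain z where "z \<notin> O\<^sub>P"
    using ring by (auto simp: valuation_ring_def)
  then have "inverse z \<in> P" "inverse z \<noteq> 0"
    using inverse_in_ideal by auto
  then show ?thesis by blast
qed

text \<open>If \<open>t\<close> does not generate \<open>P\<close>, some \<open>t'\<close> in
  \<open>P\<close> is not a multiple of \<open>t\<close>, and in a valuation ring \<open>t\<close>
  is then a multiple of \<open>t'\<close> by an element of \<open>P\<close>. Iteration contradicts
  \<open>bounded_chain\<close>.\<close>

lemma local_parameter_exists: "\<exists>t. local_parameter P t"
proof (rule ccontr)
  assume no: "\<nexists>t. local_parameter P t"
  have "\<exists>t'. t' \<in> P \<and> t' \<noteq> 0 \<and> t / t' \<in> P" if t: "t \<in> P" "t \<noteq> 0" for t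
  proof -
    have "(\<lambda>y. t * y) ` O\<^sub>P \<subseteq> P"
      using t by (intro image_subsetI) simp
    moreover have "P \<noteq> (\<lambda>y. t * y) ` O\<^sub>P"
      using no unfolding local_parameter_def by blast
    ultimately obtain t' where t': "t' \<in> P" "t' \<notin> (\<lambda>y. t * y) ` O\<^sub>P"
      by blast
    have "t' \<noteq> t * y" if "y \<in> O\<^sub>P" for y
      using t'(2) that by blast
    note * = this[of 0] this[of "t' / t"]
    have "t' \<noteq> 0"
      using *(1) by simp
    moreover have "t' / t \<notin> O\<^sub>P"
      using *(2) t(2) by auto
    then have "t / t' \<in> P"
      using inverse_in_ideal[of "t' / t"] by simp
    ultimately show ?thesis
      using t' by blast
  qed
  then obtain nxt where step: "\<And>t. t \<in> P \<Longrightarrow> t \<noteq> 0 \<Longrightarrow> nxt t \<in> P \<and> nxt t \<noteq> 0 \<and> t / nxt t \<in> P"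
    by metis
  obtain x where x: "x \<in> P" "x \<noteq> 0"
    using ideal_nontrivial by blast
  have "(nxt ^^ i) x \<in> P \<and> (nxt ^^ i) x \<noteq> 0" for i
    using x step by (induction i) auto
  note iterate = this
  obtain N where "\<forall>y. y 0 = x \<longrightarrow> (\<forall>i<N. y i \<noteq> 0 \<and> y i \<in> P) \<longrightarrow>
      \<not> (\<forall>i. Suc i < N \<longrightarrow> y i / y (Suc i) \<in> P)"
    using bounded_chain[OF x(2,1)] ..
  from this[rule_format, of "\<lambda>i. (nxt ^^ i) x"] show False
    using iterate step by simp
qed

lemma local_parameter_in_ideal: "local_parameter P t \<Longrightarrow> t \<in> P"
  using image_eqI[of t "\<lambda>y. t * y" 1 O\<^sub>P] by (simp add: local_parameter_def)

lemma local_parameter_nonzero: "local_parameter P t \<Longrightarrow> t \<noteq> 0"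
  using ideal_nontrivial by (auto simp: local_parameter_def)

lemma in_ideal_iff_divide:
  assumes "local_parameter P t"
  shows "x \<in> P \<longleftrightarrow> x / t \<in> O\<^sub>P"
proof
  show "x / t \<in> O\<^sub>P" if "x \<in> P"
  proof -
    have "x \<in> (\<lambda>y. t * y) ` O\<^sub>P"
      using that assms by (simp add: local_parameter_def)
    then show ?thesis
      using local_parameter_nonzero[OF assms] by auto
  qed
  show "x \<in> P" if "x / t \<in> O\<^sub>P"
    using ideal_closed(3)[OF that local_parameter_in_ideal[OF assms]]
      local_parameter_nonzero[OF assms] by simp
qed

text \<open>Otherwise every power of \<open>t\<close> divides \<open>z\<close>, and \<open>z\<close>
  followed by descending powers of \<open>t\<close> gives chains of any length.\<close>

lemma ring_decomposition:
  assumes t: "local_parameter P t" and z: "z \<in> O\<^sub>P" "z \<noteq> 0"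
  shows "\<exists>m u. place_unit u \<and> z = t ^ m * u"
proof (rule ccontr)
  assume contr: "\<nexists>m u. place_unit u \<and> z = t ^ m * u"
  note t0 = local_parameter_nonzero[OF t] and tP = local_parameter_in_ideal[OF t]
  have nonunit: "\<not> place_unit (z / t ^ m)" for m
    using contr t0 by (auto dest!: spec[of _ m] spec[of _ "z / t ^ m"])
  have div: "z / t ^ m \<in> O\<^sub>P" for m
  proof (induction m)
    case (Suc m)
    then have "z / t ^ m / t \<in> O\<^sub>P"
      using in_ideal_or_unit nonunit in_ideal_iff_divide[OF t] by blast
    then show ?case
      by (simp add: mult.commute)
  qed (use z in simp)
  have "z \<in> P"
    using in_ideal_or_unit[OF z(1)] nonunit[of 0] by simp
  obtain N where N: "\<forall>y. y 0 = z \<longrightarrow> (\<forall>i<N. y i \<noteq> 0 \<and> y i \<in> P) \<longrightarrow>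
      \<not> (\<forall>i. Suc i < N \<longrightarrow> y i / y (Suc i) \<in> P)"
    using bounded_chain[OF z(2) \<open>z \<in> P\<close>] ..
  \<comment> \<open>The chain is \<open>z, t ^ N, ..., t ^ 2\<close>. Its first quotient lies in
    \<open>P\<close> because even \<open>t ^ Suc N\<close> divides \<open>z\<close>.\<close>
  define y where "y i = (if i = 0 then z else t ^ (N - i) * t)" for i
  have "y i \<noteq> 0 \<and> y i \<in> P" if "i < N" for i
    using \<open>z \<in> P\<close> z t0 tP by (auto simp: y_def)
  moreover have "y i / y (Suc i) \<in> P" if "Suc i < N" for i
  proof (cases "i = 0")
    case True
    have "z / t ^ (N - 1) / t = z / t ^ (Suc N) * t"
      using that t0 by (cases N) (simp_all add: divide_simps)
    also have "\<dots> \<in> P"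
      using div[of "Suc N"] tP by (rule ideal_closed(3))
    finally show ?thesis
      using True by (simp add: y_def)
  next
    case False
    have "N - i = Suc (N - Suc i)"
      using that by simp
    then show ?thesis
      using False tP t0 by (simp add: y_def)
  qed
  ultimately show False
    using N[rule_format, of y] by (simp add: y_def)
qed

lemma decomposition:
  assumes t: "local_parameter P t" and z: "z \<noteq> 0"
  shows "\<exists>m u. place_unit u \<and> z = t powi m * u"
proof (cases "z \<in> O\<^sub>P")
  case True
  then obtain m u where "place_unit u" "z = t ^ m * u"
    using ring_decomposition[OF t] z by blast
  then show ?thesis
    by (intro exI[of _ "int m"] exI[of _ u]) (simp add: power_int_def)
next
  case False
  then have "inverse z \<in> O\<^sub>P" "inverse z \<noteq> 0"
    using ring_total z by auto
  then obtain m u where u: "place_unit u" "inverse z = t ^ m * u"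
    using ring_decomposition[OF t] by blast
  then have "z = inverse (t ^ m * u)"
    by (metis inverse_inverse_eq)
  then have "z = t powi (- int m) * inverse u"
    by (simp add: power_int_minus)
  with u(1) show ?thesis
    using place_unit_inverse by blast
qed

lemma power_int_unit_iff:
  assumes t: "local_parameter P t"
  shows "place_unit (t powi m) \<longleftrightarrow> m = 0"
proof
  have pos: "t powi k \<in> P" if "k > 0" for k
  proof -
    obtain j where "k = int (Suc j)"
      using \<open>k > 0\<close> by (metis Suc_pred' of_nat_0_less_iff zero_less_imp_eq_int)
    then have "t powi k = t ^ j * t"
      by (simp only: power_int_of_nat power_Suc2)
    also have "\<dots> \<in> P"
      using local_parameter_in_ideal[OF t] by simp
    finally show ?thesis .
  qed
  assume *: "place_unit (t powi m)"
  then have "place_unit (t powi (- m))"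
    using place_unit_inverse by (simp add: power_int_minus)
  with * show "m = 0"
    using pos[of m] pos[of "- m"] not_unit_in_ideal by (metis linorder_neqE neg_0_less_iff_less)
qed simp

text \<open>Two local parameters differ by a unit, so the exponent does not depend on the choice;
  this makes the description in \<open>val\<close> definite.\<close>

lemma val_eqI:
  assumes t: "local_parameter P t" and u: "place_unit u" and z: "z = t powi m * u"
  shows "val P z = m"
  unfolding val_def
proof (rule the_equality)
  show "\<exists>t u. local_parameter P t \<and> u \<in> O\<^sub>P \<and> u \<noteq> 0 \<and> inverse u \<in> O\<^sub>P \<and> z = t powi m * u"
    using assms by (auto simp: place_unit_def)
  fix k assume "\<exists>t u. local_parameter P t \<and> u \<in> O\<^sub>P \<and> u \<noteq> 0 \<and> inverse u \<in> O\<^sub>P \<and> z = t powi k * u"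
  then obtain t' u' where *: "local_parameter P t'" "place_unit u'" "z = t' powi k * u'"
    by (auto simp: place_unit_def)
  note nz = local_parameter_nonzero[OF t] local_parameter_nonzero[OF *(1)]
  have w: "place_unit (t' / t)"
    using in_ideal_iff_divide[OF t] in_ideal_iff_divide[OF *(1)]
      local_parameter_in_ideal[OF t] local_parameter_in_ideal[OF *(1)] nz
    by (auto simp: place_unit_def)
  have "t powi m * u = t powi k * ((t' / t) powi k * u')"
    using z * nz by (simp add: power_int_divide_distrib)
  moreover have "u \<noteq> 0"
    using u by (simp add: place_unit_def)
  ultimately have "t powi (m - k) = (t' / t) powi k * u' * inverse u"
    using nz by (simp add: power_int_diff field_simps)
  also have "place_unit \<dots>"
    using w * u by (intro place_unit_mult place_unit_inverse place_unit_power_int)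
  finally show "k = m"
    using power_int_unit_iff[OF t] by simp
qed

section \<open>Arithmetic of the valuation\<close>

lemma val_mult:
  assumes "x \<noteq> 0" "y \<noteq> 0"
  shows "val P (x * y) = val P x + val P y"
proof -
  obtain t where t: "local_parameter P t"
    using local_parameter_exists by blast
  obtain m u where x: "place_unit u" "x = t powi m * u"
    using decomposition[OF t \<open>x \<noteq> 0\<close>] by blast
  obtain k w where y: "place_unit w" "y = t powi k * w"
    using decomposition[OF t \<open>y \<noteq> 0\<close>] by blast
  have "x * y = t powi (m + k) * (u * w)"
    using x y local_parameter_nonzero[OF t] by (simp add: power_int_add)
  then show ?thesis
    using x y val_eqI[OF t] place_unit_mult by metis
qed

lemma val_unit: "place_unit u \<Longrightarrow> val P u = 0"
  using local_parameter_exists val_eqI[of _ u u 0] by auto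

lemma val_one [simp]: "val P 1 = 0"
  by (simp add: val_unit)

lemma val_local_parameter_power_int: "local_parameter P t \<Longrightarrow> val P (t powi m) = m"
  using val_eqI[of t 1 "t powi m" m] by simp

lemma val_nonneg_iff:
  assumes "z \<noteq> 0"
  shows "val P z \<ge> 0 \<longleftrightarrow> z \<in> O\<^sub>P"
proof -
  obtain t where t: "local_parameter P t"
    using local_parameter_exists by blast
  have ge: "z \<in> O\<^sub>P" if z: "z \<noteq> 0" "val P z \<ge> 0" for z
  proof -
    obtain m u where *: "place_unit u" "z = t powi m * u"
      using decomposition[OF t z(1)] by blast
    then have "m \<ge> 0"
      using z val_eqI[OF t] by simp
    then show ?thesis
      using * local_parameter_in_ideal[OF t] by (auto simp: place_unit_def power_int_def)
  qed
  have "val P z \<ge> 0" if "z \<in> O\<^sub>P"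
  proof (rule ccontr)
    assume neg: "\<not> val P z \<ge> 0"
    have "val P z + val P (inverse z) = 0"
      using val_mult[of z "inverse z"] assms by simp
    then have "inverse z \<in> O\<^sub>P"
      using ge[of "inverse z"] neg assms by simp
    then show False
      using that assms val_unit[of z] neg by (simp add: place_unit_def)
  qed
  with ge assms show ?thesis by blast
qed

lemma val_ge_0_iff: "val_ge P 0 x \<longleftrightarrow> x \<in> O\<^sub>P"
  using val_nonneg_iff[of x] by (cases "x = 0") (auto simp: val_ge_def)

lemma val_ge_shift:
  assumes t: "local_parameter P t"
  shows "val_ge P (m + k) (t powi m * x) \<longleftrightarrow> val_ge P k x"
  using local_parameter_nonzero[OF t] val_mult[of "t powi m" x]
    val_local_parameter_power_int[OF t] by (cases "x = 0") (auto simp: val_ge_def)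

text \<open>Reduces every order to order 0, so that the ultrametric inequality becomes closure of
  \<open>O\<^sub>P\<close> under addition.\<close>

lemma val_ge_iff_ring:
  assumes t: "local_parameter P t"
  shows "val_ge P m x \<longleftrightarrow> t powi (- m) * x \<in> O\<^sub>P"
  using val_ge_shift[OF t, of "- m" m x] by (simp add: val_ge_0_iff)

lemma val_ge_1_iff: "val_ge P 1 x \<longleftrightarrow> x \<in> P"
proof -
  obtain t where t: "local_parameter P t"
    using local_parameter_exists by blast
  have "t powi (- 1) * x = x / t"
    by (simp add: power_int_minus field_simps)
  then show ?thesis
    using val_ge_iff_ring[OF t, of 1 x] in_ideal_iff_divide[OF t, of x] by (simp only:)
qed

lemma val_ge_add: "val_ge P m x \<Longrightarrow> val_ge P m y \<Longrightarrow> val_ge P m (x + y)"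
proof -
  assume *: "val_ge P m x" "val_ge P m y"
  obtain t where "local_parameter P t"
    using local_parameter_exists ..
  note iff = val_ge_iff_ring[OF this, of m]
  show ?thesis
    using * unfolding iff distrib_left by (rule ring_closed(6))
qed

lemma val_ge_minus_iff [simp]: "val_ge P m (- x) \<longleftrightarrow> val_ge P m x"
proof -
  have "val_ge P m (- x)" if "val_ge P m x" for x
  proof -
    obtain t where "local_parameter P t"
      using local_parameter_exists ..
    note iff = val_ge_iff_ring[OF this, of m]
    show ?thesis
      using that ring_closed(5) unfolding iff by fastforce
  qed
  from this[of x] this[of "- x"] show ?thesis by auto
qed

lemma val_ge_diff: "val_ge P m x \<Longrightarrow> val_ge P m y \<Longrightarrow> val_ge P m (x - y)"
  using val_ge_add[of m x "- y"] by simp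

lemma val_ge_sum: "(\<And>i. i \<in> I \<Longrightarrow> val_ge P m (f i)) \<Longrightarrow> val_ge P m (\<Sum>i\<in>I. f i)"
  by (induction I rule: infinite_finite_induct) (auto intro: val_ge_add)

lemma val_ge_mult: "val_ge P m x \<Longrightarrow> val_ge P k y \<Longrightarrow> val_ge P (m + k) (x * y)"
  using val_mult[of x y] by (cases "x = 0"; cases "y = 0") (auto simp: val_ge_def)

lemma val_ge_const [simp]: "val_ge P 0 (\<kappa> c)"
  by (simp add: val_ge_0_iff)

lemma val_ge_power: "val_ge P m x \<Longrightarrow> val_ge P (int k * m) (x ^ k)"
  by (induction k) (auto simp: algebra_simps val_ge_mult val_ge_0_iff)

text \<open>Degree 1 gives a residue basis \<open>{b}\<close>, where \<open>b\<close> may differ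
  from 1. Expanding 1 itself gives \<open>c1\<close> with \<open>\<kappa> c1 * b\<close> congruent
  to 1, so division by \<open>c1\<close> turns coordinates with respect to \<open>b\<close> into
  constants.\<close>

lemma residue_constant:
  assumes rat: "rational_place \<kappa> P" and y: "y \<in> O\<^sub>P"
  shows "\<exists>c. y - \<kappa> c \<in> P"
proof -
  have "\<exists>B. residue_basis \<kappa> P B \<and> card B = 1"
    using rat someI_ex[of "residue_basis \<kappa> P"]
    by (auto simp: rational_place_def place_degree_def split: if_splits)
  then obtain b where b: "residue_basis \<kappa> P {b}"
    by (auto simp: card_1_singleton_iff)
  have rep: "\<exists>c. z - \<kappa> c * b \<in> P" if "z \<in> O\<^sub>P" for z
  proof -
    have "\<exists>c. z - (\<Sum>b\<in>{b}. \<kappa> (c b) * b) \<in> P"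
      using b that unfolding residue_basis_def by blast
    then show ?thesis by auto
  qed
  have bO: "b \<in> O\<^sub>P"
    using b by (simp add: residue_basis_def)
  obtain c1 where c1: "1 - \<kappa> c1 * b \<in> P"
    using rep[of 1] by auto
  obtain c where c: "y - \<kappa> c * b \<in> P"
    using rep y by blast
  have "c1 \<noteq> 0"
    using c1 by auto
  have "\<kappa> (c / c1) * (1 - \<kappa> c1 * b) = \<kappa> (c / c1) - \<kappa> (c / c1 * c1) * b"
    by (simp only: const_mult algebra_simps) simp
  then have "\<kappa> (c / c1) - \<kappa> c * b \<in> P"
    using ideal_closed(3)[OF ring_closed(1)[of "c / c1"] c1] \<open>c1 \<noteq> 0\<close> by simp
  then have "(y - \<kappa> c * b) - (\<kappa> (c / c1) - \<kappa> c * b) \<in> P"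
    using c by (rule ideal_diff[rotated])
  then show ?thesis
    by auto
qed

lemma eval_at:
  assumes "rational_place \<kappa> P" and "y \<in> O\<^sub>P"
  shows "y - \<kappa> (eval_at \<kappa> P y) \<in> P"
proof -
  obtain c where c: "y - \<kappa> c \<in> P"
    using residue_constant assms by blast
  have "c' = c" if "y - \<kappa> c' \<in> P" for c'
  proof -
    have "(y - \<kappa> c) - (y - \<kappa> c') \<in> P"
      using ideal_diff[OF c that] .
    then have "\<kappa> (c' - c) \<in> P"
      by (simp add: const_diff)
    then show ?thesis by simp
  qed
  with c show ?thesis
    unfolding eval_at_def by (metis (mono_tags, lifting) theI)
qed

text \<open>Subtract the residue, divide by \<open>t\<close>, repeat: after \<open>N\<close> steps
  the remainder is \<open>t ^ N\<close> times a ring element.\<close>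

lemma expansion:
  assumes rat: "rational_place \<kappa> P" and t: "local_parameter P t" and y: "y \<in> O\<^sub>P"
  shows "\<exists>c. \<forall>N. val_ge P (int N) (y - (\<Sum>a<N. \<kappa> (c a) * t ^ a))"
proof -
  obtain r where r: "\<And>w. w \<in> O\<^sub>P \<Longrightarrow> w - \<kappa> (r w) \<in> P"
    using residue_constant[OF rat] by metis
  define w where "w i = ((\<lambda>w. (w - \<kappa> (r w)) / t) ^^ i) y" for i
  have wO: "w i \<in> O\<^sub>P" for i
    using y r by (induction i) (auto simp: w_def in_ideal_iff_divide[OF t])
  have wSuc: "w i = \<kappa> (r (w i)) + t * w (Suc i)" for i
    using local_parameter_nonzero[OF t] by (simp add: w_def)
  have "y - (\<Sum>a<N. \<kappa> (r (w a)) * t ^ a) = t ^ N * w N" for N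
  proof (induction N)
    case (Suc N)
    have "y - (\<Sum>a<Suc N. \<kappa> (r (w a)) * t ^ a) = t ^ N * w N - \<kappa> (r (w N)) * t ^ N"
      using Suc by simp
    also have "\<dots> = t ^ Suc N * w (Suc N)"
      by (subst (1) wSuc[of N]) (simp add: algebra_simps)
    finally show ?case .
  qed (simp add: w_def)
  moreover have "val_ge P (int N) (t ^ N * w N)" for N
    using val_ge_shift[OF t, of "int N" 0 "w N"] wO by (simp add: val_ge_0_iff)
  ultimately show ?thesis
    by metis
qed

text \<open>Once the lower coefficients are known to vanish, \<open>\<kappa> (c a) * t ^ a\<close>
  has order at least \<open>a + 1\<close>, and the only constant in \<open>P\<close> is 0.\<close>

lemma expansion_vanishes:
  assumes t: "local_parameter P t"
    and c: "\<And>N. val_ge P (int N) (y - (\<Sum>a<N. \<kappa> (c a) * t ^ a))"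
    and y: "val_ge P (int k) y" and "a < k"
  shows "c a = 0"
  using \<open>a < k\<close>
proof (induction a rule: less_induct)
  case (less a)
  have "(\<Sum>i<Suc a. \<kappa> (c i) * t ^ i) = \<kappa> (c a) * t ^ a"
    using less by simp
  then have "val_ge P (int (Suc a)) (y - \<kappa> (c a) * t ^ a)"
    using c[of "Suc a"] by simp
  moreover have "val_ge P (int (Suc a)) y"
    using y by (rule val_ge_mono) (use less in simp)
  ultimately have "val_ge P (int (Suc a)) (y - (y - \<kappa> (c a) * t ^ a))"
    using val_ge_diff by blast
  then have "val_ge P (int a + 1) (t powi int a * \<kappa> (c a))"
    by (simp add: mult.commute add.commute)
  then have "val_ge P 1 (\<kappa> (c a))"
    by (simp only: val_ge_shift[OF t])
  then show ?case
    by (simp add: val_ge_1_iff)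
qed

end

section \<open>Existence of poles\<close>

text \<open>The descent step in Chevalley's extension theorem: given \<open>p(z) = 1 = q(1/z)\<close> with
  coefficients in \<open>I\<close>, multiply the first equation by \<open>1 - q\<^sub>0\<close> and use \<open>z\<^sup>n\<^sup>-\<^sup>m\<close> times the
  second to eliminate the leading term.\<close>

lemma chevalley_descent:
  fixes z :: "'a::field"
  assumes S: "1 \<in> S" "\<And>x y. x \<in> S \<Longrightarrow> y \<in> S \<Longrightarrow> x - y \<in> S"
    and I: "I \<subseteq> S" "0 \<in> I" "1 \<notin> I" "\<And>x y. x \<in> I \<Longrightarrow> y \<in> I \<Longrightarrow> x + y \<in> I"
      "\<And>a x. a \<in> S \<Longrightarrow> x \<in> I \<Longrightarrow> a * x \<in> I"
    and z: "z \<noteq> 0"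
    and p: "\<And>i. coeff p i \<in> I" "poly p z = 1"
    and q: "\<And>i. coeff q i \<in> I" "poly q (inverse z) = 1"
    and deg: "degree q \<le> degree p"
  shows "\<exists>p'. (\<forall>i. coeff p' i \<in> I) \<and> poly p' z = 1 \<and> degree p' < degree p"
proof -
  define n m b a where "n = degree p" "m = degree q" "b = coeff q 0" "a = coeff p n"
  \<comment> \<open>\<open>r\<close> is \<open>z ^ m * q(1/z)\<close> without its term
    \<open>b * z ^ m\<close>, so its coefficients vanish from \<open>m\<close> on and its value at
    \<open>z\<close> is \<open>(1 - b) * z ^ m\<close>. In \<open>p'\<close> it replaces the leading
    term of \<open>(1 - b) * p\<close>; adding \<open>[:b:]\<close> restores the value 1.\<close>
  define r where "r = reflect_poly q - monom b m"
  define p' where "p' = smult (1 - b) (p - monom a n) + [:b:] + smult a (monom 1 (n - m) * r)"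
  have minus: "- x \<in> I" if "x \<in> I" for x
    using I(5)[OF S(2)[OF S(2)[OF S(1,1)] S(1)] that] by simp
  have r: "coeff r i \<in> I" for i
    using q(1) I(2) by (auto simp: r_def n_m_b_a_def coeff_reflect_poly)
  have r_deg: "coeff r i = 0" if "m \<le> i" for i
    using that by (auto simp: r_def n_m_b_a_def coeff_reflect_poly)
  have n: "n > 0"
  proof (rule ccontr)
    assume "\<not> n > 0"
    then obtain c where "p = [:c:]"
      by (metis degree_eq_zeroE gr0I n_m_b_a_def(1))
    then show False
      using p(2) p(1)[of 0] I(3) by simp
  qed
  have "poly (reflect_poly q) z = z ^ m"
    using poly_reflect_poly_nz[OF z, of q] q(2) by (simp add: n_m_b_a_def)
  then have r_z: "poly r z = (1 - b) * z ^ m"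
    by (simp add: r_def poly_monom algebra_simps)
  have "poly p' z = (1 - b) * (1 - a * z ^ n) + b + a * (z ^ (n - m) * ((1 - b) * z ^ m))"
    by (simp add: p'_def poly_monom p(2) r_z)
  also have "z ^ (n - m) * ((1 - b) * z ^ m) = (1 - b) * z ^ n"
    using deg by (simp add: n_m_b_a_def flip: power_add)
  finally have "poly p' z = 1"
    by (simp add: algebra_simps)
  moreover have "coeff p' i \<in> I" for i
  proof -
    have "b \<in> I" "a \<in> I"
      using p q by (auto simp: n_m_b_a_def)
    then have "(1 - b) * coeff (p - monom a n) i \<in> I"
      using p(1) I S by (intro I(5)) (auto simp: n_m_b_a_def)
    moreover have "coeff [:b:] i \<in> I"
      using \<open>b \<in> I\<close> I(2) by (cases i) auto
    moreover have "coeff (monom 1 (n - m) * r) i \<in> I"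
      using r I(2) by (simp add: coeff_monom_mult)
    then have "a * coeff (monom 1 (n - m) * r) i \<in> I"
      using \<open>a \<in> I\<close> I by blast
    ultimately show ?thesis
      unfolding p'_def coeff_add coeff_smult using I(4) by blast
  qed
  moreover have "degree p' < n"
  proof (rule degree_lessI)
    show "\<forall>i\<ge>n. coeff p' i = 0"
    proof (intro allI impI)
      fix i assume i: "n \<le> i"
      have "coeff (p - monom a n) i = 0"
        using i by (cases "i = n") (auto simp: n_m_b_a_def coeff_eq_0)
      moreover have "coeff [:b:] i = 0"
        using i n by (cases i) auto
      moreover have "coeff (monom 1 (n - m) * r) i = 0"
        using i deg r_deg[of "i - (n - m)"] by (simp add: coeff_monom_mult n_m_b_a_def)
      ultimately show "coeff p' i = 0"
        by (simp add: p'_def)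
    qed
  qed (use n in simp)
  ultimately show ?thesis
    unfolding n_m_b_a_def by blast
qed

text \<open>Descent on the total degree. The roles of \<open>p\<close> at \<open>z\<close> and
  \<open>q\<close> at \<open>1/z\<close> are symmetric, so the polynomial of larger degree can
  always be shortened.\<close>

lemma no_chevalley_pair:
  fixes z :: "'a::field"
  assumes S: "1 \<in> S" "\<And>x y. x \<in> S \<Longrightarrow> y \<in> S \<Longrightarrow> x - y \<in> S"
    and I: "I \<subseteq> S" "0 \<in> I" "1 \<notin> I" "\<And>x y. x \<in> I \<Longrightarrow> y \<in> I \<Longrightarrow> x + y \<in> I"
      "\<And>a x. a \<in> S \<Longrightarrow> x \<in> I \<Longrightarrow> a * x \<in> I"
    and z: "z \<noteq> 0"
    and p: "\<And>i. coeff p i \<in> I" "poly p z = 1"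
    and q: "\<And>i. coeff q i \<in> I" "poly q (inverse z) = 1"
  shows False
  using z p q
proof (induction "degree p + degree q" arbitrary: p q z rule: less_induct)
  case less
  show False
  proof (cases "degree q \<le> degree p")
    case True
    then obtain p' where "\<And>i. coeff p' i \<in> I" "poly p' z = 1" "degree p' < degree p"
      using chevalley_descent[OF S I less.prems] by blast
    then show False
      using less.hyps[of p' q z] less.prems by simp
  next
    case False
    then obtain q' where "\<And>i. coeff q' i \<in> I" "poly q' (inverse z) = 1" "degree q' < degree q"
      using chevalley_descent[OF S I, of "inverse z" q p] less.prems by auto
    then show False
      using less.hyps[of p q' z] less.prems by simp
  qed
qed

context finite_function_field
begin

text \<open>Among the rings that contain the constants and \<open>1/h\<close> but not
  \<open>h\<close>, a maximal one turns out to be a valuation ring, and its place is a pole of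
  \<open>h\<close>. Zorn's lemma starts from \<open>K[1/h]\<close>.\<close>

lemma pole_exists:
  assumes full: "full_constant_field \<kappa>" and h: "h \<notin> range \<kappa>"
  shows "\<exists>P\<in>places \<kappa>. h \<notin> place_ring P"
proof -
  define Ss where "Ss = {S. range \<kappa> \<subseteq> S \<and> (\<forall>x\<in>S. \<forall>y\<in>S. x - y \<in> S \<and> x * y \<in> S) \<and>
    inverse h \<in> S \<and> h \<notin> S}"
  have h0: "h \<noteq> 0"
    using h const_zero by (metis rangeI)
  have "range (ev (inverse h)) \<in> Ss"
  proof -
    have "\<kappa> c \<in> range (ev (inverse h))" for c
      by (rule range_eqI[of _ _ "[:c:]"]) simp
    moreover have "u - v \<in> range (ev (inverse h)) \<and> u * v \<in> range (ev (inverse h))"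
      if uv: "u \<in> range (ev (inverse h))" "v \<in> range (ev (inverse h))" for u v
    proof -
      obtain p q where "u = ev (inverse h) p" "v = ev (inverse h) q"
        using uv by blast
      then have "u - v = ev (inverse h) (p + smult (- 1) q)" "u * v = ev (inverse h) (p * q)"
        by (simp_all only: ev_mult ev_add ev_smult const_minus const_one) simp
      then show ?thesis by blast
    qed
    moreover have "inverse h \<in> range (ev (inverse h))"
      by (rule range_eqI[of _ _ "[:0, 1:]"]) (simp add: const_one)
    \<comment> \<open>\<open>h = p(1/h)\<close> would make \<open>1/h\<close> a root of
      \<open>z * p(z) - 1\<close>, hence algebraic and therefore constant.\<close>
    moreover have "h \<notin> range (ev (inverse h))"
    proof
      assume "h \<in> range (ev (inverse h))"
      then obtain p where p: "h = ev (inverse h) p" by blast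
      have "ev (inverse h) (pCons (- 1) p) = 0"
        using h0 by (simp add: p[symmetric] const_minus const_one)
      moreover have "pCons (- 1) p \<noteq> 0"
        by simp
      ultimately have "\<not> transcendental_over \<kappa> (inverse h)"
        unfolding transcendental_over_iff by blast
      then obtain c where "inverse h = \<kappa> c"
        using full by (auto simp: full_constant_field_def)
      then have "h = \<kappa> (inverse c)"
        by (metis const_inverse inverse_inverse_eq)
      then show False
        using h by blast
    qed
    ultimately show ?thesis
      by (auto simp: Ss_def)
  qed
  then have "\<exists>S\<in>Ss. \<forall>X\<in>Ss. S \<subseteq> X \<longrightarrow> X = S"
  proof (intro subset_Zorn_nonempty)
    fix C assume C: "C \<noteq> {}" "subset.chain Ss C"
    then have mem: "S \<in> Ss" if "S \<in> C" for S
      using that unfolding subset_chain_def by blast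
    have common: "\<exists>S\<in>C. x \<in> S \<and> y \<in> S" if xy: "x \<in> \<Union>C" "y \<in> \<Union>C" for x y
    proof -
      obtain X Y where XY: "X \<in> C" "x \<in> X" "Y \<in> C" "y \<in> Y"
        using xy by blast
      then have "X \<subseteq> Y \<or> Y \<subseteq> X"
        using C(2) unfolding subset_chain_def by blast
      with XY show ?thesis by blast
    qed
    have "x - y \<in> \<Union>C \<and> x * y \<in> \<Union>C" if xy: "x \<in> \<Union>C" "y \<in> \<Union>C" for x y
    proof -
      obtain X where X: "X \<in> C" "x \<in> X" "y \<in> X"
        using common[OF xy] by blast
      then have "x - y \<in> X \<and> x * y \<in> X"
        using mem[OF X(1)] by (simp add: Ss_def)
      with X(1) show ?thesis by blast
    qed
    moreover obtain X where "X \<in> C"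
      using C(1) by blast
    then have "range \<kappa> \<subseteq> \<Union>C" "inverse h \<in> \<Union>C"
      using mem[of X] unfolding Ss_def by blast+
    moreover have "h \<notin> \<Union>C"
      using mem unfolding Ss_def by blast
    ultimately show "\<Union>C \<in> Ss"
      unfolding Ss_def by blast
  qed blast
  then obtain S where S: "S \<in> Ss" and maximal: "\<And>X. X \<in> Ss \<Longrightarrow> S \<subseteq> X \<Longrightarrow> X = S"
    by blast
  have const: "\<kappa> c \<in> S" and diff: "x \<in> S \<Longrightarrow> y \<in> S \<Longrightarrow> x - y \<in> S"
    and mult: "x \<in> S \<Longrightarrow> y \<in> S \<Longrightarrow> x * y \<in> S"
    and hS: "inverse h \<in> S" "h \<notin> S" for c x y
    using S unfolding Ss_def by blast+
  have zero: "0 \<in> S" and one: "1 \<in> S"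
    using const[of 0] const[of 1] by (simp_all add: const_one)
  have add: "x + y \<in> S" if "x \<in> S" "y \<in> S" for x y
    using diff[OF that(1) diff[OF zero that(2)]] by simp
  have sum: "(\<Sum>i\<in>J. f i) \<in> S" if "\<And>i. i \<in> J \<Longrightarrow> f i \<in> S" for J :: "nat set" and f
    using that by (induction J rule: infinite_finite_induct) (auto intro: zero add)
  define I where "I = (\<lambda>x. inverse h * x) ` S"
  \<comment> \<open>By maximality, adjoining \<open>z\<close> to \<open>S\<close> produces
    \<open>h = p(z)\<close> with coefficients in \<open>S\<close>; dividing by \<open>h\<close>
    moves them into \<open>I\<close>. For \<open>z\<close> and \<open>1/z\<close> both outside
    \<open>S\<close> this yields the pair excluded by \<open>no_chevalley_pair\<close>.\<close>
  have relation: "\<exists>p. (\<forall>i. coeff p i \<in> I) \<and> poly p z = 1" if z: "z \<notin> S" for z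
  proof -
    define X where "X = {poly p z | p. \<forall>i. coeff p i \<in> S}"
    have "x \<in> X" if "x \<in> S" for x
      unfolding X_def using that zero
      by (auto intro!: exI[of _ "[:x:]"] simp: coeff_pCons split: nat.split)
    then have "S \<subseteq> X" by blast
    have "z \<in> X"
      unfolding X_def using zero one
      by (auto intro!: exI[of _ "[:0, 1:]"] simp: coeff_pCons split: nat.split)
    have closed: "u - v \<in> X \<and> u * v \<in> X" if uv: "u \<in> X" "v \<in> X" for u v
    proof -
      obtain p q where "u = poly p z" "v = poly q z"
          and pq: "\<And>i. coeff p i \<in> S" "\<And>i. coeff q i \<in> S"
        using uv by (auto simp: X_def)
      then have "u - v = poly (p - q) z" "u * v = poly (p * q) z"
        by simp_all
      moreover have "coeff (p - q) i \<in> S" "coeff (p * q) i \<in> S" for i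
        using pq by (auto simp: coeff_mult intro!: diff sum mult)
      ultimately show ?thesis
        unfolding X_def by blast
    qed
    have "X \<notin> Ss"
      using maximal[of X] \<open>S \<subseteq> X\<close> \<open>z \<in> X\<close> z by blast
    then have "h \<in> X"
      using closed \<open>S \<subseteq> X\<close> const hS(1) by (auto simp: Ss_def)
    then obtain p where p: "h = poly p z" "\<And>i. coeff p i \<in> S"
      by (auto simp: X_def)
    then have "poly (smult (inverse h) p) z = 1" "\<And>i. coeff (smult (inverse h) p) i \<in> I"
      using h0 by (simp_all add: I_def p(1)[symmetric])
    then show ?thesis by blast
  qed
  have I_S: "I \<subseteq> S"
    using mult hS by (auto simp: I_def)
  have I_zero: "0 \<in> I"
    using zero by (force simp: I_def)
  have I_one: "1 \<notin> I"
  proof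
    assume "1 \<in> I"
    then obtain x where "x \<in> S" "1 = inverse h * x"
      by (auto simp: I_def)
    then have "h \<in> S"
      using h0 by (simp add: field_simps)
    with hS show False by blast
  qed
  have I_add: "x + y \<in> I" if "x \<in> I" "y \<in> I" for x y
    using that add by (auto simp: I_def simp flip: distrib_left)
  have I_mult: "a * x \<in> I" if "a \<in> S" "x \<in> I" for a x
    using that mult by (auto simp: I_def mult.left_commute[of a])
  have total: "z \<in> S \<or> inverse z \<in> S" if "z \<noteq> 0" for z
  proof (rule ccontr)
    assume "\<not> (z \<in> S \<or> inverse z \<in> S)"
    then obtain p q where pq: "\<forall>i. coeff p i \<in> I" "poly p z = 1"
        "\<forall>i. coeff q i \<in> I" "poly q (inverse z) = 1"
      using relation[of z] relation[of "inverse z"] by auto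
    show False
      using no_chevalley_pair[OF one diff I_S I_zero I_one I_add I_mult that, of p q] pq by simp
  qed
  have "inverse h \<notin> range \<kappa>"
  proof
    assume "inverse h \<in> range \<kappa>"
    then obtain c where "inverse h = \<kappa> c" ..
    then have "h = \<kappa> (inverse c)"
      by (metis const_inverse inverse_inverse_eq)
    then show False
      using h by blast
  qed
  then have "range \<kappa> \<subset> S" "S \<subset> UNIV"
    using const hS by auto
  then have R: "valuation_ring \<kappa> S"
    unfolding valuation_ring_def using diff mult total by simp
  then have "nonunits S \<in> places \<kappa>"
    using maximal_ideal_nonunits by (auto simp: places_def)
  moreover have "place_ring (nonunits S) = S"
    using place_ring_eq R maximal_ideal_nonunits by blast
  ultimately show ?thesis
    using hS by blast
qed

end

section \<open>Riemann--Roch spaces\<close>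

lemma divisor_degree_superset:
  assumes "finite X" "Poly_Mapping.keys A \<subseteq> X"
  shows "divisor_degree \<kappa> A = (\<Sum>P\<in>X. Poly_Mapping.lookup A P * int (place_degree \<kappa> P))"
  unfolding divisor_degree_def using assms
  by (intro sum.mono_neutral_left) (auto simp: in_keys_iff)

lemma divisor_degree_add: "divisor_degree \<kappa> (A + B) = divisor_degree \<kappa> A + divisor_degree \<kappa> B"
proof -
  let ?X = "Poly_Mapping.keys A \<union> Poly_Mapping.keys B"
  have "Poly_Mapping.keys (A + B) \<subseteq> ?X"
    by (rule keys_add)
  then show ?thesis
    using divisor_degree_superset[of ?X _ \<kappa>]
    by (simp add: lookup_add distrib_right sum.distrib)
qed

lemma divisor_degree_cmul: "divisor_degree \<kappa> (frag_cmul m A) = m * divisor_degree \<kappa> A"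
proof -
  have "Poly_Mapping.keys (frag_cmul m A) \<subseteq> Poly_Mapping.keys A"
    by (rule keys_cmul)
  then show ?thesis
    using divisor_degree_superset[of "Poly_Mapping.keys A" _ \<kappa>]
    by (simp add: sum_distrib_left mult.assoc)
qed

lemma divisor_degree_minus: "divisor_degree \<kappa> (- A) = - divisor_degree \<kappa> A"
  using divisor_degree_cmul[of \<kappa> "- 1" A] by simp

lemma divisor_degree_diff: "divisor_degree \<kappa> (A - B) = divisor_degree \<kappa> A - divisor_degree \<kappa> B"
  using divisor_degree_add[of \<kappa> A "- B"] by (simp add: divisor_degree_minus)

lemma divisor_degree_zero: "divisor_degree \<kappa> 0 = 0"
  by (simp add: divisor_degree_def)

lemma divisor_degree_frag_of: "divisor_degree \<kappa> (frag_of P) = int (place_degree \<kappa> P)"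
  by (simp add: divisor_degree_def)

lemma divisor_degree_sum: "divisor_degree \<kappa> (\<Sum>i\<in>I. A i) = (\<Sum>i\<in>I. divisor_degree \<kappa> (A i))"
  by (induction I rule: infinite_finite_induct)
    (simp_all add: divisor_degree_zero divisor_degree_add)

lemma divisors_zero: "0 \<in> divisors \<kappa>"
  by (simp add: divisors_def)

lemma divisors_cmul: "A \<in> divisors \<kappa> \<Longrightarrow> frag_cmul m A \<in> divisors \<kappa>"
  using keys_cmul[of m A] by (auto simp: divisors_def)

lemma divisors_add: "A \<in> divisors \<kappa> \<Longrightarrow> B \<in> divisors \<kappa> \<Longrightarrow> A + B \<in> divisors \<kappa>"
  using Poly_Mapping.keys_add[of A B] by (auto simp: divisors_def)

lemma divisors_diff: "A \<in> divisors \<kappa> \<Longrightarrow> B \<in> divisors \<kappa> \<Longrightarrow> A - B \<in> divisors \<kappa>"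
  using keys_diff[of A B] by (auto simp: divisors_def)

lemma divisors_sum:
  "(\<And>i. i \<in> I \<Longrightarrow> A i \<in> divisors \<kappa>) \<Longrightarrow> (\<Sum>i\<in>I. A i) \<in> divisors \<kappa>"
  by (induction I rule: infinite_finite_induct) (auto intro: divisors_zero divisors_add)

lemma divisors_frag_of: "P \<in> places \<kappa> \<Longrightarrow> frag_of P \<in> divisors \<kappa>"
  by (simp add: divisors_def)

context finite_function_field
begin

section \<open>Closure properties and sizes of the spaces L(A)\<close>

lemma place_locale: "P \<in> places \<kappa> \<Longrightarrow> function_field_place \<kappa> P"
  by unfold_locales

lemma riemann_roch_iff:
  "h \<in> riemann_roch_space \<kappa> A \<longleftrightarrow> (\<forall>P\<in>places \<kappa>. val_ge P (- Poly_Mapping.lookup A P) h)"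
  by (cases "h = 0") (auto simp: riemann_roch_space_def val_ge_def algebra_simps)

lemma riemann_roch_val_ge:
  "h \<in> riemann_roch_space \<kappa> A \<Longrightarrow> P \<in> places \<kappa> \<Longrightarrow> val_ge P (- Poly_Mapping.lookup A P) h"
  by (simp add: riemann_roch_iff)

lemma riemann_roch_zero [simp]: "0 \<in> riemann_roch_space \<kappa> A"
  by (simp add: riemann_roch_iff)

lemma riemann_roch_add:
  assumes "f \<in> riemann_roch_space \<kappa> A" "h \<in> riemann_roch_space \<kappa> A"
  shows "f + h \<in> riemann_roch_space \<kappa> A"
  unfolding riemann_roch_iff
proof
  fix P assume "P \<in> places \<kappa>"
  then interpret function_field_place \<kappa> P
    by (rule place_locale)
  show "val_ge P (- Poly_Mapping.lookup A P) (f + h)"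
    using assms place by (intro val_ge_add riemann_roch_val_ge)
qed

lemma riemann_roch_mult:
  assumes "f \<in> riemann_roch_space \<kappa> A" "h \<in> riemann_roch_space \<kappa> B"
  shows "f * h \<in> riemann_roch_space \<kappa> (A + B)"
  unfolding riemann_roch_iff
proof
  fix P assume "P \<in> places \<kappa>"
  then interpret function_field_place \<kappa> P
    by (rule place_locale)
  have "val_ge P (- Poly_Mapping.lookup A P + - Poly_Mapping.lookup B P) (f * h)"
    using assms place by (intro val_ge_mult riemann_roch_val_ge)
  then show "val_ge P (- Poly_Mapping.lookup (A + B) P) (f * h)"
    by (simp add: lookup_add)
qed

lemma riemann_roch_const: "\<kappa> c \<in> riemann_roch_space \<kappa> 0"
  unfolding riemann_roch_iff
proof
  fix P assume "P \<in> places \<kappa>"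
  then interpret function_field_place \<kappa> P
    by (rule place_locale)
  show "val_ge P (- Poly_Mapping.lookup 0 P) (\<kappa> c)"
    by simp
qed

lemma riemann_roch_scale:
  "h \<in> riemann_roch_space \<kappa> A \<Longrightarrow> \<kappa> c * h \<in> riemann_roch_space \<kappa> A"
  using riemann_roch_mult[OF riemann_roch_const] by (metis add_0)

lemma riemann_roch_minus:
  "h \<in> riemann_roch_space \<kappa> A \<Longrightarrow> - h \<in> riemann_roch_space \<kappa> A"
  using riemann_roch_scale[of h A "- 1"] by (simp add: const_minus const_one)

lemma riemann_roch_diff:
  "f \<in> riemann_roch_space \<kappa> A \<Longrightarrow> h \<in> riemann_roch_space \<kappa> A \<Longrightarrow>
    f - h \<in> riemann_roch_space \<kappa> A"
  using riemann_roch_add[of f A "- h"] riemann_roch_minus by simp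

lemma riemann_roch_sum:
  "(\<And>i. i \<in> I \<Longrightarrow> f i \<in> riemann_roch_space \<kappa> A) \<Longrightarrow> (\<Sum>i\<in>I. f i) \<in> riemann_roch_space \<kappa> A"
  by (induction I rule: infinite_finite_induct) (auto intro: riemann_roch_add)

lemma riemann_roch_power:
  "h \<in> riemann_roch_space \<kappa> A \<Longrightarrow> h ^ m \<in> riemann_roch_space \<kappa> (frag_cmul (int m) A)"
proof (induction m)
  case 0
  then show ?case
    using riemann_roch_const[of 1] by (simp add: const_one)
next
  case (Suc m)
  then have "h * h ^ m \<in> riemann_roch_space \<kappa> (A + frag_cmul (int m) A)"
    by (intro riemann_roch_mult)
  then show ?case
    by (simp add: frag_cmul_distrib)
qed

text \<open>Junk value: \<open>dim\<close> is 0 on spaces of infinite dimension, for which the claim is weaker.\<close>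

lemma riemann_roch_finite_subset:
  assumes g: "has_genus \<kappa> g" and A: "A \<in> divisors \<kappa>"
  obtains W d where "W \<subseteq> riemann_roch_space \<kappa> A" "finite W" "card W = CARD('k) ^ d"
    "divisor_degree \<kappa> A + 1 - g \<le> int d"
proof -
  interpret V: vector_space "\<lambda>c y. \<kappa> c * y"
    by (rule vector_space_over_constants)
  let ?L = "riemann_roch_space \<kappa> A"
  define d where "d = V.dim ?L"
  have "divisor_degree \<kappa> A - int d + 1 \<le> g"
    using g A unfolding has_genus_def Let_def d_def by blast
  then have d: "divisor_degree \<kappa> A + 1 - g \<le> int d"
    by simp
  obtain B where B: "B \<subseteq> ?L" "V.independent B" "card B = d"
    using V.basis_exists[of ?L] unfolding d_def by metis
  show ?thesis
  proof (cases "finite B")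
    case False
    then have "d = 0"
      using B by simp
    then show ?thesis
      using that[of "{0}" 0] d by simp
  next
    case True
    define comb where "comb c = (\<Sum>b\<in>B. \<kappa> (c b) * b)" for c
    have "inj_on comb (B \<rightarrow>\<^sub>E UNIV)"
    proof (rule inj_onI)
      fix c c' assume c: "c \<in> B \<rightarrow>\<^sub>E UNIV" "c' \<in> B \<rightarrow>\<^sub>E UNIV" "comb c = comb c'"
      then have "(\<Sum>b\<in>B. \<kappa> (c b - c' b) * b) = 0"
        by (simp add: comb_def const_diff left_diff_distrib sum_subtractf)
      then have "c b - c' b = 0" if "b \<in> B" for b
        using V.independentD[OF B(2) True subset_refl, of "\<lambda>b. c b - c' b"] that by blast
      then show "c = c'"
        using c by (intro PiE_ext[of c B "\<lambda>_. UNIV"]) auto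
    qed
    then have "card (comb ` (B \<rightarrow>\<^sub>E UNIV)) = CARD('k) ^ d"
      using True B by (simp add: card_image card_PiE)
    moreover have "comb ` (B \<rightarrow>\<^sub>E UNIV) \<subseteq> ?L"
      using B by (auto simp: comb_def intro!: riemann_roch_sum riemann_roch_scale)
    moreover have "finite (comb ` (B \<rightarrow>\<^sub>E UNIV))"
      using True by (intro finite_imageI finite_PiE) auto
    ultimately show ?thesis
      using that d by blast
  qed
qed

lemma riemann_roch_zero_divisor:
  assumes "full_constant_field \<kappa>"
  shows "riemann_roch_space \<kappa> 0 \<subseteq> range \<kappa>"
proof
  fix h assume h: "h \<in> riemann_roch_space \<kappa> 0"
  show "h \<in> range \<kappa>"
  proof (rule ccontr)
    assume "h \<notin> range \<kappa>"
    then obtain P where P: "P \<in> places \<kappa>" "h \<notin> place_ring P"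
      using pole_exists assms by blast
    then interpret function_field_place \<kappa> P
      by (intro place_locale)
    show False
      using riemann_roch_val_ge[OF h P(1)] P(2) by (simp add: val_ge_0_iff)
  qed
qed

lemma card_constants: "card (range \<kappa>) = CARD('k)"
  by (intro card_image injI) simp

text \<open>Riemann's inequality at the zero divisor, where \<open>L(0)\<close> has at most as many
  elements as the constant field.\<close>

lemma genus_nonneg:
  assumes "full_constant_field \<kappa>" "has_genus \<kappa> g"
  shows "g \<ge> 0"
proof -
  obtain W d where W: "W \<subseteq> riemann_roch_space \<kappa> 0" "card W = CARD('k) ^ d"
      "divisor_degree \<kappa> 0 + 1 - g \<le> int d"
    using riemann_roch_finite_subset[OF assms(2) divisors_zero] by blast
  have "card W \<le> card (range \<kappa>)"
    using W riemann_roch_zero_divisor[OF assms(1)] by (intro card_mono) auto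
  then have "CARD('k) ^ d \<le> CARD('k) ^ 1"
    using W by (simp add: card_constants)
  then have "d \<le> 1"
    using card_field_gt_1 power_le_imp_le_exp by blast
  then show ?thesis
    using W by (simp add: divisor_degree_zero)
qed

text \<open>If \<open>0 \<noteq> h \<in> L(A)\<close> with \<open>deg A < 0\<close>, then multiplication by \<open>h\<^sup>m\<close> embeds \<open>L(-mA)\<close>, whose
  dimension is unbounded by Riemann's inequality, into \<open>L(0)\<close>. This avoids the product formula.\<close>

lemma riemann_roch_negative_degree:
  assumes full: "full_constant_field \<kappa>" and g: "has_genus \<kappa> g"
    and A: "A \<in> divisors \<kappa>" "divisor_degree \<kappa> A < 0"
  shows "riemann_roch_space \<kappa> A = {0}"
proof (rule ccontr)
  assume "riemann_roch_space \<kappa> A \<noteq> {0}"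
  then obtain h where h: "h \<in> riemann_roch_space \<kappa> A" "h \<noteq> 0"
    using riemann_roch_zero[of A] by blast
  \<comment> \<open>With this \<open>m\<close>, \<open>L(-mA)\<close> has dimension at least
    \<open>m + 1 - g = 2\<close>, more than the constants can accommodate.\<close>
  define m where "m = nat (g + 1)"
  obtain W d where W: "W \<subseteq> riemann_roch_space \<kappa> (frag_cmul (- int m) A)" "card W = CARD('k) ^ d"
      "divisor_degree \<kappa> (frag_cmul (- int m) A) + 1 - g \<le> int d"
    using riemann_roch_finite_subset[OF g divisors_cmul[OF A(1), of "- int m"]] by metis
  have "int m \<le> - int m * divisor_degree \<kappa> A"
    using A(2) mult_left_mono[of 1 "- divisor_degree \<kappa> A" "int m"] by simp
  moreover have "int m = g + 1"
    using genus_nonneg[OF full g] by (simp add: m_def)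
  ultimately have "d \<ge> 2"
    using W(3) by (simp add: divisor_degree_cmul)
  have "h ^ m * w \<in> range \<kappa>" if "w \<in> W" for w
  proof -
    have "h ^ m * w \<in> riemann_roch_space \<kappa> (frag_cmul (int m) A + frag_cmul (- int m) A)"
      using h W that by (intro riemann_roch_mult riemann_roch_power) auto
    then show ?thesis
      using riemann_roch_zero_divisor[OF full] by (auto simp flip: frag_cmul_distrib)
  qed
  then have "card W \<le> card (range \<kappa>)"
    using h by (intro card_inj_on_le[of "\<lambda>w. h ^ m * w"]) (auto simp: inj_on_def)
  then have "CARD('k) ^ d \<le> CARD('k) ^ 1"
    using W by (simp add: card_constants)
  then have "d \<le> 1"
    using card_field_gt_1 power_le_imp_le_exp by blast
  with \<open>d \<ge> 2\<close> show False by simp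
qed

end

section \<open>The interpolation argument\<close>

text \<open>The coefficient of \<open>z^b\<close> in \<open>Q(z + u)\<close> collects multiples of
  \<open>u^(j - b)\<close> times that of \<open>z^j\<close>, so a grading that \<open>u\<close>
  lowers by one is preserved. This serves for pole orders, with \<open>M j = L(A - j G)\<close> and
  \<open>u\<close> in \<open>L(G)\<close>, and for vanishing orders \<open>s - j\<close>, with
  \<open>u\<close> in the place.\<close>

lemma coeff_shift_graded:
  fixes u :: "'a::comm_ring_1" and M :: "nat \<Rightarrow> 'a set"
  assumes "\<And>j. coeff Q j \<in> M j"
    and "\<And>j x y. x \<in> M j \<Longrightarrow> y \<in> M j \<Longrightarrow> x + y \<in> M j"
    and "\<And>j x. x \<in> M (Suc j) \<Longrightarrow> u * x \<in> M j"
  shows "coeff (pcompose Q [:u, 1:]) b \<in> M b"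
  using assms
proof (induction Q arbitrary: M b)
  case 0
  then show ?case by simp
next
  case (pCons a p)
  have IH: "coeff (pcompose p [:u, 1:]) b \<in> M (Suc b)" for b
  proof (rule pCons.IH)
    show "coeff p j \<in> M (Suc j)" for j
      using pCons.prems(1)[of "Suc j"] by simp
  qed (use pCons.prems in auto)
  have eq: "pcompose (pCons a p) [:u, 1:]
      = [:a:] + smult u (pcompose p [:u, 1:]) + pCons 0 (pcompose p [:u, 1:])"
    by (simp add: pcompose_pCons)
  have "u * coeff (pcompose p [:u, 1:]) b \<in> M b"
    using IH pCons.prems(3) by blast
  moreover have "a \<in> M 0"
    using pCons.prems(1)[of 0] by simp
  ultimately show ?case
    using IH[of "b - 1"] pCons.prems(2) unfolding eq by (cases b) (auto simp: add.commute)
qed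

lemma pcompose_linear_sum:
  "pcompose R [:u, 1:] = (\<Sum>b\<le>degree R. smult (coeff R b) ([:u, 1:] ^ b))"
proof -
  have monom: "pcompose (monom a b) q = smult a (q ^ b)" for a :: 'a and b and q
    by (induction b) (simp_all add: monom_0 monom_Suc pcompose_pCons)
  have "pcompose R [:u, 1:] = pcompose (\<Sum>b\<le>degree R. monom (coeff R b) b) [:u, 1:]"
    by (simp add: poly_as_sum_of_monoms)
  then show ?thesis
    by (simp add: pcompose_sum monom)
qed

lemma pcompose_shift_shift:
  fixes Q :: "'a::comm_ring_1 poly"
  shows "pcompose (pcompose Q [:u, 1:]) [:v, 1:] = pcompose Q [:u + v, 1:]"
  by (simp add: pcompose_pCons flip: pcompose_assoc)

text \<open>The sum is the number of pairs \<open>(a, b)\<close> with \<open>a + b < s\<close>, the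
  coefficients that multiplicity \<open>s\<close> kills.\<close>

lemma sum_staircase: "2 * (\<Sum>b<s. s - b) = s * (s + 1)" for s :: nat
proof -
  have "(\<Sum>b<s. s - b) = (\<Sum>b<s. Suc b)"
    by (rule sum.reindex_bij_witness[of _ "\<lambda>b. s - Suc b" "\<lambda>b. s - Suc b"]) auto
  also have "2 * \<dots> = s * (s + 1)"
    by (induction s) auto
  finally show ?thesis .
qed

text \<open>The same triangle without its row \<open>b = 0\<close>, which is the saving at places of
  agreement.\<close>

lemma sum_staircase_tail:
  fixes s :: nat
  shows "2 * (\<Sum>b\<in>{1..<s}. s - b) = s * (s - 1)"
proof (cases s)
  case (Suc m)
  have "(\<Sum>b<s. s - b) = s + (\<Sum>b\<in>{1..<s}. s - b)"
    by (simp add: Suc lessThan_atLeast0 sum.atLeast_Suc_lessThan)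
  then show ?thesis
    using sum_staircase[of s] by (simp add: Suc)
qed simp

context function_field_place
begin

text \<open>Encodes an element modulo order \<open>m + k\<close> by \<open>k\<close> constants, its
  first series coefficients. The pigeonhole principle supplies two elements with equal digits and
  passes to their difference, so \<open>\<delta>\<close> only has to control collisions.\<close>

lemma digits:
  assumes "rational_place \<kappa> P"
  shows "\<exists>\<delta> :: 'f \<Rightarrow> nat \<Rightarrow> 'k. \<forall>w w' k. val_ge P m w \<longrightarrow> val_ge P m w' \<longrightarrow>
    (\<forall>a<k. \<delta> w a = \<delta> w' a) \<longrightarrow> val_ge P (m + int k) (w - w')"
proof -
  obtain t where t: "local_parameter P t"
    using local_parameter_exists ..
  obtain c where c: "\<And>y N. y \<in> O\<^sub>P \<Longrightarrow> val_ge P (int N) (y - (\<Sum>a<N. \<kappa> (c y a) * t ^ a))"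
    using expansion[OF assms t] by metis
  define \<delta> where "\<delta> w = c (t powi (- m) * w)" for w
  have "val_ge P (m + int k) (w - w')"
    if w: "val_ge P m w" "val_ge P m w'" and eq: "\<forall>a<k. \<delta> w a = \<delta> w' a" for w w' k
  proof -
    define y y' where "y = t powi (- m) * w" and "y' = t powi (- m) * w'"
    have "y \<in> O\<^sub>P" "y' \<in> O\<^sub>P"
      using w by (simp_all add: y_def y'_def val_ge_iff_ring[OF t])
    then have "val_ge P (int k)
        ((y - (\<Sum>a<k. \<kappa> (c y a) * t ^ a)) - (y' - (\<Sum>a<k. \<kappa> (c y' a) * t ^ a)))"
      by (intro val_ge_diff[OF c c])
    moreover have "(\<Sum>a<k. \<kappa> (c y a) * t ^ a) = (\<Sum>a<k. \<kappa> (c y' a) * t ^ a)"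
      using eq by (intro sum.cong) (auto simp: \<delta>_def y_def y'_def)
    ultimately have "val_ge P (int k) (y - y')"
      by simp
    then have "val_ge P (m + int k) (t powi m * (y - y'))"
      by (simp only: val_ge_shift[OF t])
    moreover have "t powi m * (t powi (- m) * z) = z" for z
      using local_parameter_nonzero[OF t] by (simp add: power_int_minus field_simps)
    then have "t powi m * (y - y') = w - w'"
      by (simp only: y_def y'_def right_diff_distrib)
    ultimately show ?thesis
      by (simp only:)
  qed
  then show ?thesis by blast
qed

text \<open>The \<open>d b\<close> of the definition are forced to be the coefficients of
  \<open>Q(z + \<kappa> r)\<close>, and vanishing of the first \<open>s - b\<close> series
  coefficients means order at least \<open>s - b\<close>. For \<open>b \<ge> s\<close> truncated
  subtraction leaves regularity, which having a power series demands.\<close>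

lemma zero_of_mult_iff:
  assumes rat: "rational_place \<kappa> P"
  shows "zero_of_mult \<kappa> P r Q s \<longleftrightarrow>
    (\<forall>b. val_ge P (int (s - b)) (coeff (pcompose Q [:\<kappa> r, 1:]) b))"
proof
  assume "zero_of_mult \<kappa> P r Q s"
  then obtain \<phi> c d where Q: "Q = (\<Sum>b\<le>degree Q. smult (d b) ([:- \<kappa> r, 1:] ^ b))"
      and d: "\<And>b N. b \<le> degree Q \<Longrightarrow> val_ge P (int N) (d b - (\<Sum>a<N. \<kappa> (c a b) * \<phi> ^ a))"
      and c: "\<And>a b. a + b < s \<Longrightarrow> c a b = 0"
    unfolding zero_of_mult_def Let_def val_ge_def by blast
  define R where "R = (\<Sum>b\<le>degree Q. monom (d b) b)"
  have "pcompose Q [:\<kappa> r, 1:] = (\<Sum>b\<le>degree Q. smult (d b) (pcompose ([:- \<kappa> r, 1:] ^ b) [:\<kappa> r, 1:]))"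
    by (subst (1) Q) (simp add: pcompose_sum pcompose_smult)
  also have "\<dots> = R"
  proof -
    have "pcompose ([:- \<kappa> r, 1:] ^ b) [:\<kappa> r, 1:] = monom 1 b" for b
    proof (induction b)
      case (Suc b)
      show ?case
        unfolding power_Suc pcompose_mult Suc by (simp add: pcompose_pCons monom_Suc)
    qed (simp add: pcompose_1)
    then show ?thesis
      by (simp add: R_def smult_monom)
  qed
  finally have R: "pcompose Q [:\<kappa> r, 1:] = R" .
  show "\<forall>b. val_ge P (int (s - b)) (coeff (pcompose Q [:\<kappa> r, 1:]) b)"
  proof
    fix b
    show "val_ge P (int (s - b)) (coeff (pcompose Q [:\<kappa> r, 1:]) b)"
    proof (cases "b \<le> degree Q")
      case True
      have "(\<Sum>a<s - b. \<kappa> (c a b) * \<phi> ^ a) = 0"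
        using c by (intro sum.neutral) auto
      then show ?thesis
        using d[OF True, of "s - b"] True by (simp add: R R_def coeff_sum)
    next
      case False
      then show ?thesis
        by (simp add: R R_def coeff_sum)
    qed
  qed
next
  assume val: "\<forall>b. val_ge P (int (s - b)) (coeff (pcompose Q [:\<kappa> r, 1:]) b)"
  define R where "R = pcompose Q [:\<kappa> r, 1:]"
  have deg: "degree R = degree Q"
    by (simp add: R_def degree_pcompose)
  obtain t where t: "local_parameter P t"
    using local_parameter_exists ..
  have "coeff R b \<in> O\<^sub>P" for b
    using val val_ge_mono[of P "int (s - b)" "coeff R b" 0] by (simp add: R_def val_ge_0_iff)
  then have "\<forall>b. \<exists>c. \<forall>N. val_ge P (int N) (coeff R b - (\<Sum>a<N. \<kappa> (c a) * t ^ a))"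
    using expansion[OF rat t] by blast
  then obtain c where c: "\<And>b N. val_ge P (int N) (coeff R b - (\<Sum>a<N. \<kappa> (c b a) * t ^ a))"
    by metis
  have "c b a = 0" if "a + b < s" for a b
  proof (rule expansion_vanishes[OF t c])
    show "val_ge P (int (s - b)) (coeff R b)"
      using val by (simp add: R_def)
    show "a < s - b"
      using that by simp
  qed
  moreover have "Q = (\<Sum>b\<le>degree Q. smult (coeff R b) ([:- \<kappa> r, 1:] ^ b))"
    using pcompose_linear_sum[of R "- \<kappa> r"] pcompose_shift_shift[of Q "\<kappa> r" "- \<kappa> r"]
    by (simp add: deg flip: R_def)
  ultimately show "zero_of_mult \<kappa> P r Q s"
    unfolding zero_of_mult_def Let_def using t c
    by (intro exI[of _ t] exI[of _ "\<lambda>a b. c b a"] exI[of _ "coeff R"]) (simp add: val_ge_def)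
qed

end

section \<open>The decoder for a fixed code\<close>

locale ag_code = finite_function_field \<kappa>
  for \<kappa> :: "'k::{field,finite} \<Rightarrow> 'f::field" +
  fixes P :: "nat \<Rightarrow> 'f set" and G :: "'f set \<Rightarrow>\<^sub>0 int" and n :: nat and g :: int
  assumes full: "full_constant_field \<kappa>"
    and genus: "has_genus \<kappa> g"
    and rational: "i \<in> {1..n} \<Longrightarrow> rational_place \<kappa> (P i)"
    and inj: "inj_on P {1..n}"
    and G: "G \<in> divisors \<kappa>"
    and disjoint: "Poly_Mapping.keys G \<inter> Poly_Mapping.keys (eval_divisor n P) = {}"
begin

lemma place_P: "i \<in> {1..n} \<Longrightarrow> P i \<in> places \<kappa>"
  using rational by (simp add: rational_place_def)

lemma lookup_sum_P:
  assumes "I \<subseteq> {1..n}"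
  shows "Poly_Mapping.lookup (\<Sum>i\<in>I. frag_of (P i)) X = (if X \<in> P ` I then 1 else 0)"
proof -
  have fin: "finite I"
    using assms finite_subset by blast
  show ?thesis
  proof (cases "X \<in> P ` I")
    case True
    then obtain i where i: "i \<in> I" "X = P i" by blast
    have "(X = P j) = (j = i)" if "j \<in> I" for j
      using inj i that assms by (auto dest: inj_onD)
    then have "(\<Sum>j\<in>I. if X = P j then 1 else 0 :: int) = (\<Sum>j\<in>I. if j = i then 1 else 0)"
      by (intro sum.cong) auto
    also have "\<dots> = 1"
      using fin i by simp
    finally show ?thesis
      using True by (simp add: lookup_sum)
  next
    case False
    then show ?thesis
      by (auto simp: lookup_sum intro!: sum.neutral)
  qed
qed

lemma lookup_disjoint:
  assumes "Poly_Mapping.keys A \<inter> Poly_Mapping.keys (eval_divisor n P) = {}" and "i \<in> {1..n}"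
  shows "Poly_Mapping.lookup A (P i) = 0"
proof -
  have "P i \<in> Poly_Mapping.keys (eval_divisor n P)"
    using assms(2) lookup_sum_P[of "{1..n}" "P i"] by (simp add: in_keys_iff eval_divisor_def)
  then show ?thesis
    using assms(1) by (auto simp: in_keys_iff)
qed

lemma riemann_roch_regular:
  assumes "f \<in> riemann_roch_space \<kappa> G" "i \<in> {1..n}"
  shows "f \<in> place_ring (P i)"
proof -
  interpret function_field_place \<kappa> "P i"
    using place_P assms by (intro place_locale)
  show ?thesis
    using riemann_roch_val_ge[OF assms(1) place] lookup_disjoint[OF disjoint assms(2)]
    by (simp add: val_ge_0_iff)
qed

lemma agreement:
  assumes "f \<in> riemann_roch_space \<kappa> G" "i \<in> {1..n}" "codeword \<kappa> n P f i = r i"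
  shows "f - \<kappa> (r i) \<in> P i"
proof -
  interpret function_field_place \<kappa> "P i"
    using place_P assms by (intro place_locale)
  show ?thesis
    using eval_at[OF rational[OF assms(2)] riemann_roch_regular[OF assms(1,2)]] assms(2,3)
    by (simp add: codeword_def)
qed

text \<open>The interpolation condition without the assumption that the support of \<open>A\<close> avoids the
  evaluation places: the multiplicity at \<open>P i\<close> is counted from \<open>- A(P i)\<close>. This yields a bound
  on the list size from \<open>A = m P\<^sub>1\<close>, without constructing an admissible divisor.\<close>

definition interpolant :: "('f set \<Rightarrow>\<^sub>0 int) \<Rightarrow> (nat \<Rightarrow> 'k) \<Rightarrow> nat \<Rightarrow> nat \<Rightarrow> 'f poly \<Rightarrow> bool" where
  "interpolant A r s l Q \<longleftrightarrow> Q \<noteq> 0 \<and> degree Q \<le> l \<and>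
    (\<forall>j. coeff Q j \<in> riemann_roch_space \<kappa> (A - frag_cmul (int j) G)) \<and>
    (\<forall>i\<in>{1..n}. \<forall>b. val_ge (P i) (int (s - b) - Poly_Mapping.lookup A (P i))
       (coeff (pcompose Q [:\<kappa> (r i), 1:]) b))"

lemma gs_interpolant_iff:
  assumes "gs_admissible_divisor \<kappa> n P s \<tau> A"
  shows "gs_interpolant \<kappa> n P G s l A r Q \<longleftrightarrow> interpolant A r s l Q"
proof -
  have "Poly_Mapping.lookup A (P i) = 0" if "i \<in> {1..n}" for i
    using assms that by (auto simp: gs_admissible_divisor_def intro: lookup_disjoint)
  then have "zero_of_mult \<kappa> (P i) (r i) Q s \<longleftrightarrow>
      (\<forall>b. val_ge (P i) (int (s - b) - Poly_Mapping.lookup A (P i))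
        (coeff (pcompose Q [:\<kappa> (r i), 1:]) b))" if "i \<in> {1..n}" for i
    using that function_field_place.zero_of_mult_iff[OF place_locale[OF place_P] rational] by simp
  moreover have "(\<forall>j\<le>l. coeff Q j \<in> riemann_roch_space \<kappa> (A - frag_cmul (int j) G)) \<longleftrightarrow>
      (\<forall>j. coeff Q j \<in> riemann_roch_space \<kappa> (A - frag_cmul (int j) G))" if "degree Q \<le> l"
  proof -
    have "coeff Q j \<in> riemann_roch_space \<kappa> (A - frag_cmul (int j) G)" if "\<not> j \<le> l" for j
      using that \<open>degree Q \<le> l\<close> by (simp add: coeff_eq_0)
    then show ?thesis by blast
  qed
  ultimately show ?thesis
    unfolding gs_interpolant_def interpolant_def by blast
qed

text \<open>A factor \<open>f ^ k\<close> gives back \<open>k\<close> copies of \<open>G\<close>.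
  With \<open>j = 0\<close> this puts \<open>Q(f)\<close> in \<open>L(A)\<close>; with
  \<open>k = 1\<close> it is the grading condition for the shift by \<open>f\<close>.\<close>

lemma riemann_roch_graded_mult:
  assumes "f \<in> riemann_roch_space \<kappa> G"
    and "x \<in> riemann_roch_space \<kappa> (A - frag_cmul (int (k + j)) G)"
  shows "x * f ^ k \<in> riemann_roch_space \<kappa> (A - frag_cmul (int j) G)"
proof -
  have "x * f ^ k \<in> riemann_roch_space \<kappa> (A - frag_cmul (int (k + j)) G + frag_cmul (int k) G)"
    using assms by (intro riemann_roch_mult riemann_roch_power)
  then show ?thesis
    by (simp add: frag_cmul_distrib)
qed

lemma interpolant_root:
  assumes Q: "interpolant A r s l Q" and f: "f \<in> riemann_roch_space \<kappa> G"
    and dist: "hamming_dist n (codeword \<kappa> n P f) r \<le> \<tau>"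
    and A: "A \<in> divisors \<kappa>" "divisor_degree \<kappa> A < int s * (int n - int \<tau>)"
  shows "poly Q f = 0"
proof -
  define I where "I = {i \<in> {1..n}. codeword \<kappa> n P f i = r i}"
  define D where "D = (\<Sum>i\<in>I. frag_of (P i))"
  have I: "I \<subseteq> {1..n}"
    by (auto simp: I_def)
  have "n = card I + hamming_dist n (codeword \<kappa> n P f) r"
  proof -
    have "card {1..n} = card (I \<union> {i \<in> {1..n}. codeword \<kappa> n P f i \<noteq> r i})"
      by (rule arg_cong[of _ _ card]) (auto simp: I_def)
    then show ?thesis
      by (subst (asm) card_Un_disjoint) (auto simp: I_def hamming_dist_def)
  qed
  then have "int n - int \<tau> \<le> int (card I)"
    using dist by linarith
  then have "divisor_degree \<kappa> A < int s * int (card I)"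
    using A(2) mult_left_mono[of "int n - int \<tau>" "int (card I)" "int s"] by linarith
  moreover have "divisor_degree \<kappa> D = int (card I)"
    using I rational
    by (simp add: D_def divisor_degree_sum divisor_degree_frag_of rational_place_def subset_iff)
  ultimately have neg: "divisor_degree \<kappa> (A - frag_cmul (int s) D) < 0"
    by (simp add: divisor_degree_diff divisor_degree_cmul)
  have div: "A - frag_cmul (int s) D \<in> divisors \<kappa>"
    using A I place_P unfolding D_def
    by (intro divisors_diff divisors_cmul divisors_sum divisors_frag_of) auto
  have L_A: "poly Q f \<in> riemann_roch_space \<kappa> A"
    unfolding poly_altdef
    using Q riemann_roch_graded_mult[OF f, where j = 0 and A = A]
    by (intro riemann_roch_sum) (simp add: interpolant_def)
  have "poly Q f \<in> riemann_roch_space \<kappa> (A - frag_cmul (int s) D)"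
    unfolding riemann_roch_iff
  proof
    fix X assume X: "X \<in> places \<kappa>"
    interpret function_field_place \<kappa> X
      using X by (rule place_locale)
    show "val_ge X (- Poly_Mapping.lookup (A - frag_cmul (int s) D) X) (poly Q f)"
    proof (cases "X \<in> P ` I")
      case False
      then show ?thesis
        using riemann_roch_val_ge[OF L_A X] lookup_sum_P[OF I, of X]
        by (simp add: lookup_minus D_def)
    next
      case True
      then obtain i where i: "i \<in> {1..n}" "codeword \<kappa> n P f i = r i" "X = P i"
        by (auto simp: I_def)
      define R where "R = pcompose Q [:\<kappa> (r i), 1:]"
      \<comment> \<open>Around \<open>r i\<close> the term of index \<open>b\<close> has order at
        least \<open>(s - b) + b\<close>, up to the contribution of \<open>A\<close>; truncated
        subtraction makes this at least \<open>s\<close> also for \<open>b > s\<close>.\<close>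
      have "poly Q f = poly R (f - \<kappa> (r i))"
        by (simp add: R_def poly_pcompose)
      also have "\<dots> = (\<Sum>b\<le>degree R. coeff R b * (f - \<kappa> (r i)) ^ b)"
        by (rule poly_altdef)
      also have "val_ge X (int s - Poly_Mapping.lookup A X) \<dots>"
      proof (rule val_ge_sum)
        fix b
        have "val_ge X (int (s - b) - Poly_Mapping.lookup A X) (coeff R b)"
          using Q i by (simp add: interpolant_def R_def)
        moreover have "val_ge X (int b * 1) ((f - \<kappa> (r i)) ^ b)"
          using agreement[where r = r, OF f i(1,2)] unfolding i(3)[symmetric]
          by (intro val_ge_power) (simp add: val_ge_1_iff)
        ultimately have "val_ge X (int (s - b) - Poly_Mapping.lookup A X + int b * 1)
            (coeff R b * (f - \<kappa> (r i)) ^ b)"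
          by (rule val_ge_mult)
        then show "val_ge X (int s - Poly_Mapping.lookup A X) (coeff R b * (f - \<kappa> (r i)) ^ b)"
          by (rule val_ge_mono) simp
      qed
      finally show ?thesis
        using True lookup_sum_P[OF I, of X] by (simp add: lookup_minus D_def)
    qed
  qed
  then show ?thesis
    using riemann_roch_negative_degree[OF full genus div neg] by blast
qed

text \<open>The left side of \<open>count\<close> is twice the number of scalar conditions, the
  right side twice Riemann's lower bound for the total dimension of the spaces
  \<open>L(A - j G)\<close> with \<open>1 \<le> j \<le> l\<close>, from which the coefficients of
  the powers of \<open>z - f\<close> are taken.\<close>

lemma interpolant_exists:
  assumes f: "f \<in> riemann_roch_space \<kappa> G" and A: "A \<in> divisors \<kappa>"
    and count: "int n * (int s * (int s - 1)) + 2 * int s * int (hamming_dist n (codeword \<kappa> n P f) r)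
      < 2 * (\<Sum>j=1..l. divisor_degree \<kappa> A - int j * divisor_degree \<kappa> G + 1 - g)"
  shows "\<exists>Q. interpolant A r s l Q"
proof -
  define agree where "agree i \<longleftrightarrow> codeword \<kappa> n P f i = r i" for i
  define u where "u i = \<kappa> (r i) - f" for i
  \<comment> \<open>In the variable \<open>z - f\<close> the value \<open>r i\<close> sits at
    \<open>u i\<close>. At an agreement \<open>u i\<close> vanishes at the place, and shifting by it
    preserves the required orders; the conditions are therefore imposed at 0, where the row
    \<open>b = 0\<close> is automatic because the constant term is absent.\<close>
  define u' where "u' i = (if agree i then 0 else u i)" for i
  define Bs where "Bs i = (if agree i then {1..<s} else {..<s})" for i
  define I where "I = (SIGMA i:{1..n}. SIGMA b:Bs i. {..<s - b})"
  let ?L = "\<lambda>j. riemann_roch_space \<kappa> (A - frag_cmul (int j) G)"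
  let ?a = "\<lambda>i. - Poly_Mapping.lookup A (P i)"

  have "2 * int (card I)
      = int n * (int s * (int s - 1)) + 2 * int s * int (hamming_dist n (codeword \<kappa> n P f) r)"
  proof -
    have "card I = (\<Sum>i\<in>{1..n}. \<Sum>b\<in>Bs i. s - b)"
      by (simp add: I_def card_SigmaI Bs_def)
    then have "2 * int (card I) = (\<Sum>i\<in>{1..n}. int (2 * (\<Sum>b\<in>Bs i. s - b)))"
      by (simp only: of_nat_sum of_nat_mult sum_distrib_left of_nat_numeral)
    also have "\<dots> = (\<Sum>i\<in>{1..n}. 
        int s * (int s - 1) + (if codeword \<kappa> n P f i \<noteq> r i then 2 * int s else 0))"
    proof (rule sum.cong)
      fix i
      have *: "int (s * (s - 1)) = int s * (int s - 1)"
          "int (s * (s + 1)) = int s * (int s - 1) + 2 * int s"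
        by (cases s; simp add: algebra_simps)+
      show "int (2 * (\<Sum>b\<in>Bs i. s - b))
          = int s * (int s - 1) + (if codeword \<kappa> n P f i \<noteq> r i then 2 * int s else 0)"
        using sum_staircase[of s] sum_staircase_tail[of s] *
        by (simp only: Bs_def agree_def split: if_split) simp
    qed simp
    also have "\<dots> = int n * (int s * (int s - 1)) + 2 * int s * int (hamming_dist n (codeword \<kappa> n P f) r)"
      by (simp add: sum.distrib hamming_dist_def flip: sum.inter_filter)
    finally show ?thesis .
  qed
  then have card_I: "2 * int (card I)
      < 2 * (\<Sum>j=1..l. divisor_degree \<kappa> A - int j * divisor_degree \<kappa> G + 1 - g)"
    using count by simp

  have "\<exists>W d. W \<subseteq> ?L j \<and> finite W \<and> card W = CARD('k) ^ d \<and>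
      divisor_degree \<kappa> A - int j * divisor_degree \<kappa> G + 1 - g \<le> int d" for j
    using riemann_roch_finite_subset[OF genus divisors_diff[OF A divisors_cmul[OF G, of "int j"]]]
    by (metis divisor_degree_diff divisor_degree_cmul)
  then obtain W d where W: "\<And>j. W j \<subseteq> ?L j" "\<And>j. finite (W j)" "\<And>j. card (W j) = CARD('k) ^ d j"
      "\<And>j. divisor_degree \<kappa> A - int j * divisor_degree \<kappa> G + 1 - g \<le> int (d j)"
    by metis
  define V where "V = (\<Pi>\<^sub>E j\<in>{1..l}. W j)"
  define pl where "pl v = (\<Sum>j=1..l. monom (v j) j)" for v :: "nat \<Rightarrow> 'f"
  have coeff_pl: "coeff (pl v) j = (if j \<in> {1..l} then v j else 0)" for v j
    by (simp add: pl_def coeff_sum)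
  have coeff_pl_L: "coeff (pl v) j \<in> ?L j" if "v \<in> V" for v j
    using that W(1)[of j] by (auto simp: coeff_pl V_def PiE_iff)
  have "(\<Sum>j=1..l. divisor_degree \<kappa> A - int j * divisor_degree \<kappa> G + 1 - g) \<le> int (\<Sum>j=1..l. d j)"
    using W(4) by (simp add: sum_mono)
  then have less: "card I < (\<Sum>j=1..l. d j)"
    using card_I by linarith

  have "\<exists>\<delta> :: 'f \<Rightarrow> nat \<Rightarrow> 'k. \<forall>w w' k. val_ge (P i) (?a i) w \<longrightarrow> val_ge (P i) (?a i) w' \<longrightarrow>
      (\<forall>a<k. \<delta> w a = \<delta> w' a) \<longrightarrow> val_ge (P i) (?a i + int k) (w - w')" if "i \<in> {1..n}" for i
    using function_field_place.digits[OF place_locale[OF place_P] rational] that by blast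
  then obtain \<delta> :: "nat \<Rightarrow> 'f \<Rightarrow> nat \<Rightarrow> 'k" where \<delta>: "\<And>i w w' k. i \<in> {1..n} \<Longrightarrow>
      val_ge (P i) (?a i) w \<Longrightarrow> val_ge (P i) (?a i) w' \<Longrightarrow> (\<forall>a<k. \<delta> i w a = \<delta> i w' a) \<Longrightarrow>
      val_ge (P i) (?a i + int k) (w - w')"
    by metis
  define c where "c v i b = coeff (pcompose (pl v) [:u' i, 1:]) b" for v i b
  \<comment> \<open>Collects all digits that an interpolation polynomial must kill; two coefficient
    families with the same image differ by a solution.\<close>
  define \<rho> where "\<rho> v = restrict (\<lambda>(i, b, a). \<delta> i (c v i b) a) I" for v
  have "\<rho> ` V \<subseteq> I \<rightarrow>\<^sub>E UNIV"
    by (auto simp: \<rho>_def)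
  moreover have "finite I"
    unfolding I_def by (intro finite_SigmaI) (auto simp: Bs_def)
  moreover have "card V = CARD('k) ^ (\<Sum>j=1..l. d j)"
    by (simp add: V_def card_PiE W(3) power_sum)
  ultimately have "\<not> inj_on \<rho> V"
    using card_inj_on_le[of \<rho> V "I \<rightarrow>\<^sub>E (UNIV :: 'k set)"] less card_field_gt_1
    by (auto simp: card_PiE finite_PiE)
  then obtain v v' where v: "v \<in> V" "v' \<in> V" "v \<noteq> v'" "\<rho> v = \<rho> v'"
    by (auto simp: inj_on_def)
  define Q' where "Q' = pl v - pl v'"
  define Q where "Q = pcompose Q' [:- f, 1:]"

  have "Q' \<noteq> 0"
  proof
    assume "Q' = 0"
    then have "coeff (pl v) j = coeff (pl v') j" for j
      by (simp add: Q'_def)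
    then have "v j = v' j" if "j \<in> {1..l}" for j
      using that unfolding coeff_pl by presburger
    then show False
      using v(1-3) unfolding V_def by (metis PiE_ext)
  qed
  then have "Q \<noteq> 0"
    using pcompose_eq_0[of Q' "[:- f, 1:]"] by (auto simp: Q_def)
  moreover have "degree Q \<le> l"
  proof -
    have "degree (pl v) \<le> l" for v
      by (rule degree_le) (simp add: coeff_pl)
    then show ?thesis
      by (simp add: Q_def degree_pcompose Q'_def degree_diff_le)
  qed
  moreover have "coeff Q j \<in> ?L j" for j
    unfolding Q_def
  proof (rule coeff_shift_graded)
    show "coeff Q' j \<in> ?L j" for j
      using v coeff_pl_L by (simp add: Q'_def riemann_roch_diff)
    show "- f * x \<in> ?L j" if "x \<in> ?L (Suc j)" for x j
      using riemann_roch_graded_mult[OF f, of x A 1 j] that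
      by (simp add: mult.commute riemann_roch_minus)
  qed (rule riemann_roch_add)
  moreover have "val_ge (P i) (int (s - b) - Poly_Mapping.lookup A (P i))
      (coeff (pcompose Q [:\<kappa> (r i), 1:]) b)" if i: "i \<in> {1..n}" for i b
  proof -
    interpret function_field_place \<kappa> "P i"
      using place_P[OF i] by (rule place_locale)
    have Q_shift: "pcompose Q [:\<kappa> (r i), 1:] = pcompose Q' [:u i, 1:]"
      by (simp add: Q_def pcompose_shift_shift u_def)
    have u_reg: "u i \<in> O\<^sub>P"
      using riemann_roch_regular[OF f i] by (simp add: u_def)
    have "coeff (pl v) j \<in> {x. val_ge (P i) (?a i) x}" if "v \<in> V" for v j
      using riemann_roch_val_ge[OF coeff_pl_L[OF that] place] lookup_disjoint[OF disjoint i]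
      by (simp add: lookup_minus)
    then have "c v i b \<in> {x. val_ge (P i) (?a i) x}" if "v \<in> V" for v b
      unfolding c_def
    proof (rule coeff_shift_graded)
      show "u' i * x \<in> {x. val_ge (P i) (?a i) x}" if "x \<in> {x. val_ge (P i) (?a i) x}" for x
        using val_ge_mult[of 0 "u' i" "?a i" x] u_reg that by (simp add: val_ge_0_iff u'_def)
    qed (use that in \<open>auto intro: val_ge_add\<close>)
    then have c_reg: "val_ge (P i) (?a i) (c v i b)" if "v \<in> V" for v b
      using that by simp
    have diff: "c v i b - c v' i b = coeff (pcompose Q' [:u' i, 1:]) b" for b
      by (simp add: c_def Q'_def pcompose_diff)
    \<comment> \<open>For \<open>b \<ge> s\<close> no digits are compared and regularity is enough.
      The one case left open is \<open>b = 0\<close> at an agreement.\<close>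
    have vanish: "val_ge (P i) (?a i + int (s - b)) (coeff (pcompose Q' [:u' i, 1:]) b)"
      if b: "b \<in> Bs i \<or> s \<le> b" for b
      unfolding diff[symmetric]
    proof (rule \<delta>[OF i c_reg[OF v(1)] c_reg[OF v(2)]], intro allI impI)
      fix a assume "a < s - b"
      then have "(i, b, a) \<in> I"
        using b i by (auto simp: I_def)
      then show "\<delta> i (c v i b) a = \<delta> i (c v' i b) a"
        using fun_cong[OF v(4), of "(i, b, a)"] by (simp add: \<rho>_def)
    qed
    show ?thesis
    proof (cases "agree i")
      case False
      then have "u' i = u i" and "b \<in> Bs i \<or> s \<le> b"
        by (auto simp: u'_def Bs_def)
      then show ?thesis
        using vanish[of b] by (simp add: Q_shift add.commute)
    next
      case True
      \<comment> \<open>The open case \<open>j = 0\<close> holds because \<open>pl\<close> starts at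
        index 1; the orders are then carried from 0 to \<open>u i\<close>.\<close>
      have "val_ge (P i) (?a i + int (s - j)) (coeff Q' j)" for j
      proof (cases "j = 0")
        case True
        then show ?thesis
          by (simp add: Q'_def coeff_pl)
      next
        case False
        then have "j \<in> Bs i \<or> s \<le> j"
          using \<open>agree i\<close> by (auto simp: Bs_def)
        then show ?thesis
          using vanish[of j] \<open>agree i\<close> by (simp add: u'_def)
      qed
      note coeff_Q' = this
      have u_1: "val_ge (P i) 1 (u i)"
        using agreement[of f i r, OF f i] True val_ge_minus_iff[of 1 "f - \<kappa> (r i)"]
        by (simp add: agree_def u_def val_ge_1_iff)
      have "coeff (pcompose Q' [:u i, 1:]) b \<in> {x. val_ge (P i) (?a i + int (s - b)) x}"
      proof (rule coeff_shift_graded)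
        show "u i * x \<in> {x. val_ge (P i) (?a i + int (s - j)) x}"
          if "x \<in> {x. val_ge (P i) (?a i + int (s - Suc j)) x}" for x j
        proof -
          have "val_ge (P i) (1 + (?a i + int (s - Suc j))) (u i * x)"
            using that u_1 by (intro val_ge_mult) auto
          then show ?thesis
            by (simp add: val_ge_mono)
        qed
      qed (use coeff_Q' in \<open>auto intro: val_ge_add\<close>)
      then show ?thesis
        by (simp add: Q_shift add.commute)
    qed
  qed
  ultimately show ?thesis
    unfolding interpolant_def by blast
qed

text \<open>A single polynomial has the whole list among its roots, so its degree bounds the list.
  The multiple of \<open>P 1\<close> has the right degree because \<open>P 1\<close> is
  rational.\<close>

lemma list_size_bound:
  assumes "0 < n" and A: "\<And>A. A \<in> divisors \<kappa> \<Longrightarrow> divisor_degree \<kappa> A = m \<Longrightarrow>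
      \<exists>Q. interpolant A r s l Q"
    and m: "m < int s * (int n - int \<tau>)"
  shows "finite {f \<in> riemann_roch_space \<kappa> G. hamming_dist n (codeword \<kappa> n P f) r \<le> \<tau>} \<and>
    card {f \<in> riemann_roch_space \<kappa> G. hamming_dist n (codeword \<kappa> n P f) r \<le> \<tau>} \<le> l"
    (is "finite ?C \<and> card ?C \<le> l")
proof -
  have 1: "1 \<in> {1..n}"
    using assms(1) by simp
  define A where "A = frag_cmul m (frag_of (P 1))"
  have div: "A \<in> divisors \<kappa>"
    using place_P[OF 1] by (simp only: A_def divisors_cmul divisors_frag_of)
  have deg: "divisor_degree \<kappa> A = m"
    using rational[OF 1]
    by (simp add: A_def divisor_degree_cmul divisor_degree_frag_of rational_place_def)
  obtain Q where Q: "interpolant A r s l Q"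
    using A[OF div deg] ..
  then have "Q \<noteq> 0" "degree Q \<le> l"
    by (auto simp: interpolant_def)
  have "?C \<subseteq> {x. poly Q x = 0}"
    using interpolant_root[OF Q _ _ div] m deg by auto
  then show ?thesis
    using poly_roots_finite[OF \<open>Q \<noteq> 0\<close>] card_poly_roots_bound[OF \<open>Q \<noteq> 0\<close>] \<open>degree Q \<le> l\<close>
    by (meson card_mono finite_subset le_trans)
qed

lemma radius_inequality:
  assumes s: "1 \<le> s" and tau: "real \<tau> \<le> (real s * (2 * real l - real s + 1) * real n
        - real l * (real l + 1) * real_of_int (divisor_degree \<kappa> G) - 2)
       / (2 * real s * (real l + 1))
     - real l / (real l + 1) * (real_of_int g / real s)"
  shows "2 * int s * (int l + 1) * int \<tau> \<le> int s * (2 * int l - int s + 1) * int n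
        - int l * (int l + 1) * divisor_degree \<kappa> G - 2 - 2 * int l * g"
proof -
  have "real l / (real l + 1) * (real_of_int g / real s)
      = 2 * (real l * real_of_int g) / (2 * (real s * (real l + 1)))"
    by (simp add: mult.commute)
  then have "real \<tau> \<le> (real s * (2 * real l - real s + 1) * real n
        - real l * (real l + 1) * real_of_int (divisor_degree \<kappa> G) - 2 - 2 * real l * real_of_int g)
       / (2 * real s * (real l + 1))"
    using tau by (simp only: diff_divide_distrib mult.assoc)
  then have "real \<tau> * (2 * real s * (real l + 1)) \<le> real s * (2 * real l - real s + 1) * real n
        - real l * (real l + 1) * real_of_int (divisor_degree \<kappa> G) - 2 - 2 * real l * real_of_int g"
    using s by (subst (asm) pos_le_divide_eq) auto
  then have "real_of_int (2 * int s * (int l + 1) * int \<tau>)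
      \<le> real_of_int (int s * (2 * int l - int s + 1) * int n
        - int l * (int l + 1) * divisor_degree \<kappa> G - 2 - 2 * int l * g)"
    by (simp add: ac_simps)
  then show ?thesis
    by (simp only: of_int_le_iff)
qed

lemma radius:
  assumes "1 \<le> s" "1 \<le> l"
  shows "gs_radius_at_least \<kappa> n P G s l
    ((real s * (2 * real l - real s + 1) * real n
        - real l * (real l + 1) * real_of_int (divisor_degree \<kappa> G) - 2)
       / (2 * real s * (real l + 1))
     - real l / (real l + 1) * (real_of_int g / real s))"
  unfolding gs_radius_at_least_def Let_def
proof (intro allI impI ballI, elim conjE)
  fix \<tau> :: nat and r :: "nat \<Rightarrow> 'k"
  assume "real \<tau> \<le> (real s * (2 * real l - real s + 1) * real n
        - real l * (real l + 1) * real_of_int (divisor_degree \<kappa> G) - 2)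
       / (2 * real s * (real l + 1))
     - real l / (real l + 1) * (real_of_int g / real s)"
  then have tau: "2 * int s * (int l + 1) * int \<tau> \<le> int s * (2 * int l - int s + 1) * int n
        - int l * (int l + 1) * divisor_degree \<kappa> G - 2 - 2 * int l * g"
    by (rule radius_inequality[OF assms(1)])
  define C where "C = {f \<in> riemann_roch_space \<kappa> G. hamming_dist n (codeword \<kappa> n P f) r \<le> \<tau>}"
  define m where "m = int s * (int n - int \<tau>) - 1"
  \<comment> \<open>A single close \<open>f\<close> yields an interpolation polynomial for every
    divisor of degree \<open>m\<close>. Read backwards: if the decoder finds none, there was nothing
    to decode.\<close>
  have exists: "\<exists>Q. interpolant A r s l Q"
    if A: "A \<in> divisors \<kappa>" "divisor_degree \<kappa> A = m" and f: "f \<in> C" for A f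
  proof (rule interpolant_exists)
    show "f \<in> riemann_roch_space \<kappa> G"
      using f by (simp add: C_def)
    let ?e = "hamming_dist n (codeword \<kappa> n P f) r"
    have "2 * (\<Sum>j=1..l. int j) = int l * (int l + 1)"
      by (induction l) (auto simp: algebra_simps)
    moreover have "(\<Sum>j=1..l. divisor_degree \<kappa> A - int j * divisor_degree \<kappa> G + 1 - g)
        = int l * (m + 1 - g) - (\<Sum>j=1..l. int j) * divisor_degree \<kappa> G"
    proof -
      have "(\<Sum>j=1..l. divisor_degree \<kappa> A - int j * divisor_degree \<kappa> G + 1 - g)
          = (\<Sum>j=1..l. (m + 1 - g) - int j * divisor_degree \<kappa> G)"
        using A by (intro sum.cong) auto
      then show ?thesis
        by (simp add: sum_subtractf flip: sum_distrib_right)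
    qed
    ultimately have sum: "2 * (\<Sum>j=1..l. divisor_degree \<kappa> A - int j * divisor_degree \<kappa> G + 1 - g)
        = 2 * int l * (m + 1 - g) - int l * (int l + 1) * divisor_degree \<kappa> G"
      by (simp add: right_diff_distrib flip: mult.assoc)
    have "2 * int s * int ?e \<le> 2 * int s * int \<tau>"
      using f by (intro mult_left_mono) (auto simp: C_def)
    \<comment> \<open>Here \<open>m + 1 = s * (n - \<tau>)\<close>, and the \<open>- 2\<close> in
      \<open>tau\<close> provides the strict inequality.\<close>
    with tau show "int n * (int s * (int s - 1)) + 2 * int s * int ?e
        < 2 * (\<Sum>j=1..l. divisor_degree \<kappa> A - int j * divisor_degree \<kappa> G + 1 - g)"
      unfolding sum by (simp add: m_def algebra_simps)
  qed (rule A)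
  have "finite C \<and> card C \<le> l"
  proof (cases "C = {}")
    case False
    then obtain f where "f \<in> C" by blast
    show ?thesis
    \<comment> \<open>For \<open>n = 0\<close> there is no \<open>P 1\<close> to carry a divisor of
      degree \<open>m\<close>; the radius condition then forces \<open>deg G < 0\<close>, which
      leaves at most the zero function.\<close>
    proof (cases "n = 0")
      case True
      have "0 \<le> 2 * int s * (int l + 1) * int \<tau>"
        by simp
      moreover have "0 \<le> 2 * int l * g"
        using genus_nonneg[OF full genus] by simp
      moreover have "int s * (2 * int l - int s + 1) * int n = 0"
        using True by simp
      ultimately have "int l * (int l + 1) * divisor_degree \<kappa> G < 0"
        using tau by linarith
      then have "divisor_degree \<kappa> G < 0"
        by (simp add: mult_less_0_iff)
      then have "C \<subseteq> {0}"
        using riemann_roch_negative_degree[OF full genus G] by (auto simp: C_def)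
      then have "finite C" "card C \<le> 1"
        using finite_subset[of C "{0}"] card_mono[of "{0}" C] by auto
      then show ?thesis
        using assms(2) by simp
    next
      case False
      have "m < int s * (int n - int \<tau>)"
        by (simp add: m_def)
      then show ?thesis
        using list_size_bound[of m r s l \<tau>] exists \<open>f \<in> C\<close> False unfolding C_def by blast
    qed
  qed simp
  moreover have "S = C" if A: "gs_admissible_divisor \<kappa> n P s \<tau> A"
    and S: "gs_output \<kappa> n P G s l \<tau> A r S" for A S
  proof -
    have A': "A \<in> divisors \<kappa>" "divisor_degree \<kappa> A = m"
      using A by (auto simp: gs_admissible_divisor_def m_def)
    note iff = gs_interpolant_iff[OF A]
    show ?thesis
    proof (cases "\<exists>Q. interpolant A r s l Q")
      case True
      then obtain Q where Q: "interpolant A r s l Q"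
        and S_eq: "S = {f \<in> riemann_roch_space \<kappa> G. poly Q f = 0 \<and>
          hamming_dist n (codeword \<kappa> n P f) r \<le> \<tau>}"
        using S unfolding gs_output_def iff by blast
      have "poly Q f = 0" if "f \<in> C" for f
        using interpolant_root[OF Q _ _ A'(1), of f \<tau>] that by (simp add: C_def A'(2) m_def)
      then show ?thesis
        by (auto simp: S_eq C_def)
    next
      case False
      then have "S = {}" "C = {}"
        using S exists A' unfolding gs_output_def iff by blast+
      then show ?thesis by simp
    qed
  qed
  ultimately show "finite {f \<in> riemann_roch_space \<kappa> G. hamming_dist n (codeword \<kappa> n P f) r \<le> \<tau>} \<and>
    card {f \<in> riemann_roch_space \<kappa> G. hamming_dist n (codeword \<kappa> n P f) r \<le> \<tau>} \<le> l \<and>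
    (\<forall>A S. gs_admissible_divisor \<kappa> n P s \<tau> A \<and> gs_output \<kappa> n P G s l \<tau> A r S \<longrightarrow>
      S = {f \<in> riemann_roch_space \<kappa> G. hamming_dist n (codeword \<kappa> n P f) r \<le> \<tau>})"
    unfolding C_def by blast
qed

end

theorem corollary7:
  fixes \<kappa> :: "'k::{field,finite} \<Rightarrow> 'f::field"
    and P :: "nat \<Rightarrow> 'f set"
    and G :: "'f set \<Rightarrow>\<^sub>0 int"
    and n s l :: nat and g :: int
  assumes "function_field \<kappa>"
    and "full_constant_field \<kappa>"
    and "has_genus \<kappa> g"
    and "\<And>i. i \<in> {1..n} \<Longrightarrow> rational_place \<kappa> (P i)"
    and "inj_on P {1..n}"
    and "G \<in> divisors \<kappa>"
    and "Poly_Mapping.keys G \<inter> Poly_Mapping.keys (eval_divisor n P) = {}"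
    and "1 \<le> s" and "s \<le> l"
  shows "gs_radius_at_least \<kappa> n P G s l
    ((real s * (2 * real l - real s + 1) * real n
        - real l * (real l + 1) * real_of_int (divisor_degree \<kappa> G) - 2)
       / (2 * real s * (real l + 1))
     - real l / (real l + 1) * (real_of_int g / real s))"
proof -
  interpret function_field \<kappa>
    by (rule assms(1))
  interpret ag_code \<kappa> P G n g
    using assms(2-7) by unfold_locales auto
  show ?thesis
    using radius[of s l] assms(8,9) by simp
qed

end
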